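(* Let $\Gamma$ be a Polish space and let $K\subseteq\mathbb R^\Gamma$ be a set of Baire-1 functions on $\Gamma$ which is compact in the topology of pointwise convergence on $\Gamma$. Assume that there exists a countable ordinal $\Omega$ such that for all $s\in K$ and all $\delta>0$ the $\Omega$-th derived set $J(s,\delta)^{(\Omega)}$ is empty. Then the Banach space $\mathcal C(K)$ (continuous real-valued functions on $K$ with the supremum norm) admits an equivalent norm that is lower semicontinuous for the topology $\mathfrak T_p$ of pointwise convergence on $K$ and locally uniformly rotund.
   Context: A topological space is Polish if it is separable and completely metrizable. For a function $s:\Gamma\to\mathbb R$ and $\delta>0$, $$J(s,\delta)=\{\gamma\in\Gamma:\ \operatorname{osc}(s\restriction U)>\delta\ \text{whenever } U \text{ is open and }\gamma\in U\},$$ where $\operatorname{osc}(s\restriction U)=\sup_{\alpha,\beta\in U}|s(\alpha)-s(\beta)|$. For a topological space $J$, $J'$ denotes the set of non-isolated points of $J$, and by transfinite recursion $J^{(0)}=J$ and $J^{(\eta)}=\bigcap_{\xi<\eta}(J^{(\xi)})'$ for $\eta>0$ (each $J^{(\xi)}$ having the subspace topology). $\mathfrak T_p$ denotes the topology of pointwise convergence on $K$ in $\mathcal C(K)$. A norm $\nu$ on a real vector space $X$ is locally uniformly rotund if whenever $x, x_n\in X$ ($n\in\mathbb N$) are such that $\nu(x_n)\to\nu(x)$ and $\nu(\tfrac12(x+x_n))\to\nu(x)$, one has $\nu(x-x_n)\to 0$. *)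

theory Defs
  imports "HOL-Analysis.Analysis"
begin

section \<open>Polish spaces and Baire-1 functions\<close>

definition Polish_space :: "'a topology \<Rightarrow> bool" where
  "Polish_space X \<longleftrightarrow> separable_space X \<and> completely_metrizable_space X"

definition Baire_one :: "'a topology \<Rightarrow> ('a \<Rightarrow> real) \<Rightarrow> bool" where
  "Baire_one X s \<longleftrightarrow>
     (\<exists>f :: nat \<Rightarrow> 'a \<Rightarrow> real. (\<forall>n. continuous_map X euclideanreal (f n)) \<and>
        (\<forall>x\<in>topspace X. (\<lambda>n. f n x) \<longlonglongrightarrow> s x))"

text \<open>Real functions on a set \<open>S\<close> are represented by the elements of \<open>S \<rightarrow>\<^sub>E UNIV\<close>
  (the value outside \<open>S\<close> is \<open>undefined\<close>), which is the underlying set of the following space.\<close>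

abbreviation pointwise_topology :: "'a set \<Rightarrow> ('a \<Rightarrow> real) topology" where
  "pointwise_topology S \<equiv> product_topology (\<lambda>_. euclideanreal) S"


section \<open>Oscillation and iterated derived sets\<close>

text \<open>The oscillation may be infinite, so the supremum is taken in the extended reals.\<close>

definition osc :: "('a \<Rightarrow> real) \<Rightarrow> 'a set \<Rightarrow> ereal" where
  "osc s U = (SUP (\<alpha>, \<beta>) \<in> U \<times> U. ereal \<bar>s \<alpha> - s \<beta>\<bar>)"

definition osc_set :: "'a topology \<Rightarrow> ('a \<Rightarrow> real) \<Rightarrow> real \<Rightarrow> 'a set" where
  "osc_set X s \<delta> =
     {\<gamma> \<in> topspace X. \<forall>U. openin X U \<and> \<gamma> \<in> U \<longrightarrow> osc s U > ereal \<delta>}"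

definition non_isolated :: "'a topology \<Rightarrow> 'a set \<Rightarrow> 'a set" where
  "non_isolated X J = {x \<in> J. \<not> openin (subtopology X J) {x}}"

text \<open>An ordinal is given by a well-order \<open>\<Omega>\<close> in the library's sense, and the ordinals below it by
  the elements of \<open>Field \<Omega>\<close>: the element \<open>\<eta>\<close> stands for the order type of \<open>underS \<Omega> \<eta>\<close>.
  In \<open>derived_step X J I D\<close>, the set \<open>I\<close> collects the ordinals below some ordinal \<open>\<eta>\<close>, and \<open>D \<xi>\<close>
  is the derivative of order \<open>\<xi>\<close> for each \<open>\<xi>\<close> in \<open>I\<close>; the result is the derivative of order \<open>\<eta>\<close>.\<close>

definition derived_step :: "'a topology \<Rightarrow> 'a set \<Rightarrow> 'o set \<Rightarrow> ('o \<Rightarrow> 'a set) \<Rightarrow> 'a set" where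
  "derived_step X J I D = (if I = {} then J else (\<Inter>\<xi>\<in>I. non_isolated X (D \<xi>)))"

definition derived_below :: "'a topology \<Rightarrow> 'a set \<Rightarrow> 'o rel \<Rightarrow> 'o \<Rightarrow> 'a set" where
  "derived_below X J \<Omega> = wo_rel.worec \<Omega> (\<lambda>D \<eta>. derived_step X J (underS \<Omega> \<eta>) D)"

definition derived_iterate :: "'a topology \<Rightarrow> 'a set \<Rightarrow> 'o rel \<Rightarrow> 'a set" where
  "derived_iterate X J \<Omega> = derived_step X J (Field \<Omega>) (derived_below X J \<Omega>)"

lemma derived_below_unfold:
  assumes "Well_order \<Omega>"
  shows "derived_below X J \<Omega> \<eta> = derived_step X J (underS \<Omega> \<eta>) (derived_below X J \<Omega>)"
proof -
  have wo: "wo_rel \<Omega>"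
    using assms by (simp add: wo_rel_def)
  have "wo_rel.adm_wo \<Omega> (\<lambda>D \<eta>. derived_step X J (underS \<Omega> \<eta>) D)"
    by (auto simp: wo_rel.adm_wo_def[OF wo] derived_step_def)
  from wo_rel.worec_fixpoint[OF wo this] show ?thesis
    unfolding derived_below_def by (rule fun_cong)
qed


section \<open>The space of continuous functions and norms on it\<close>

definition cfuns :: "'k topology \<Rightarrow> ('k \<Rightarrow> real) set" where
  "cfuns T = {f \<in> extensional (topspace T). continuous_map T euclideanreal f}"

definition cfuns_pointwise :: "'k topology \<Rightarrow> ('k \<Rightarrow> real) topology" where
  "cfuns_pointwise T = subtopology (pointwise_topology (topspace T)) (cfuns T)"

text \<open>The case distinction is needed because \<open>Sup {}\<close> is unspecified for reals.\<close>

definition sup_norm :: "'k topology \<Rightarrow> ('k \<Rightarrow> real) \<Rightarrow> real" where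
  "sup_norm T f = (if topspace T = {} then 0 else (SUP x\<in>topspace T. \<bar>f x\<bar>))"

text \<open>In the next definitions \<open>V\<close> is a linear space of real functions on \<open>S\<close>; the vector space
  operations are the pointwise ones, restricted to \<open>S\<close>.\<close>

definition is_norm_on :: "'k set \<Rightarrow> ('k \<Rightarrow> real) set \<Rightarrow> (('k \<Rightarrow> real) \<Rightarrow> real) \<Rightarrow> bool" where
  "is_norm_on S V \<nu> \<longleftrightarrow>
     (\<forall>f\<in>V. 0 \<le> \<nu> f) \<and>
     (\<forall>f\<in>V. \<nu> f = 0 \<longleftrightarrow> f = (\<lambda>x\<in>S. 0)) \<and>
     (\<forall>f\<in>V. \<forall>c. \<nu> (\<lambda>x\<in>S. c * f x) = \<bar>c\<bar> * \<nu> f) \<and>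
     (\<forall>f\<in>V. \<forall>g\<in>V. \<nu> (\<lambda>x\<in>S. f x + g x) \<le> \<nu> f + \<nu> g)"

definition equivalent_norms_on ::
    "('k \<Rightarrow> real) set \<Rightarrow> (('k \<Rightarrow> real) \<Rightarrow> real) \<Rightarrow> (('k \<Rightarrow> real) \<Rightarrow> real) \<Rightarrow> bool" where
  "equivalent_norms_on V \<mu> \<nu> \<longleftrightarrow>
     (\<exists>a>0. \<exists>b>0. \<forall>f\<in>V. a * \<mu> f \<le> \<nu> f \<and> \<nu> f \<le> b * \<mu> f)"

definition locally_uniformly_rotund_on ::
    "'k set \<Rightarrow> ('k \<Rightarrow> real) set \<Rightarrow> (('k \<Rightarrow> real) \<Rightarrow> real) \<Rightarrow> bool" where
  "locally_uniformly_rotund_on S V \<nu> \<longleftrightarrow>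
     (\<forall>f\<in>V. \<forall>g :: nat \<Rightarrow> 'k \<Rightarrow> real.
        (\<forall>n. g n \<in> V) \<and>
        (\<lambda>n. \<nu> (g n)) \<longlonglongrightarrow> \<nu> f \<and>
        (\<lambda>n. \<nu> (\<lambda>x\<in>S. (1/2) * (f x + g n x))) \<longlonglongrightarrow> \<nu> f
        \<longrightarrow> (\<lambda>n. \<nu> (\<lambda>x\<in>S. f x - g n x)) \<longlonglongrightarrow> 0)"

definition lower_semicontinuous_map :: "'b topology \<Rightarrow> ('b \<Rightarrow> real) \<Rightarrow> bool" where
  "lower_semicontinuous_map X h \<longleftrightarrow> (\<forall>a. openin X {x \<in> topspace X. a < h x})"

end

theory Submission
  imports Defs
begin

text \<open>
  Let \<open>D\<close> be a countable dense subset of \<open>\<Gamma>\<close>. By compactness, for \<open>f \<in> \<C>(K)\<close> and \<open>\<epsilon> > 0\<close> there are finitely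
  many control points in \<open>\<Gamma>\<close> such that \<open>f\<close> differs by at most \<open>\<epsilon>\<close> on any two \<open>s, t \<in> K\<close> that are close at these
  points. If the control points could be taken from a countable set, \<open>\<C>(K)\<close> would be separable. In general they
  cannot, and the norm has to find them: it contains suprema, over all candidate sets of
  control points, of seminorms that are largest at the right set. If the supremum at \<open>f\<close> is nearly attained
  at a single candidate, then a sequence \<open>g\<^sub>n\<close> as in the definition of local uniform rotundity must nearly attain it at the
  same candidate (\<open>midpoint_conv_SUP\<close>, a form of Deville's lemma). Each further seminorm that is
  attached with a small weight to the candidates thus satisfies the rotundity hypothesis for the right candidate
  (\<open>tower_descend\<close>).

  The seminorms that find the control points come from the derived sets. If \<open>s\<close> and \<open>t\<close> agree on \<open>D\<close> but differ by more than
  \<open>2\<delta>\<close> at \<open>\<gamma>\<close>, then \<open>\<gamma>\<close> lies in \<open>J(s,\<delta>)\<close> or in \<open>J(t,\<delta>)\<close> (\<open>difference_in_osc_sets\<close>), and there it has a rank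
  below \<open>\<Omega>\<close>, namely the order of the derivative in which it is isolated. Suppose that points \<open>M\<close> have been found and
  that \<open>D \<union> M\<close> does not yet control \<open>f\<close>. Among the pairs that agree on \<open>D \<union> M\<close> and are separated
  by \<open>f\<close>, choose one for which the ranks of the control points are minimal. Being isolated in a derivative
  is witnessed by a basic open set; so the ranks can be prescribed by countably many parameters, and the supremum
  of \<open>\<bar>f s - f t\<bar>\<close> over the pairs whose ranks are bounded in this way, with the top rank attained only in a
  small set \<open>N\<close>, is by minimality large for exactly one \<open>N\<close> (\<open>selection_step\<close>). This \<open>N\<close> contains
  a new control point. After finitely many such steps \<open>D \<union> M\<close> controls \<open>f\<close> (\<open>descend_to_control\<close>).

  Then \<open>K\<close> is covered by finitely many cells on which \<open>f\<close> is almost constant, each described by \<open>M\<close> and by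
  countably many further parameters. The seminorms of the cells show that \<open>g\<^sub>n\<close> is eventually almost constant on the
  cells, with almost the same values as \<open>f\<close> (\<open>uniform_convergence_of_midpoint_conv\<close>), whence \<open>g\<^sub>n \<rightarrow> f\<close>
  uniformly. All parameters together range over a countable set, and the norm is a weighted \<open>\<ell>\<^sup>2\<close> sum of the
  corresponding seminorms. Lower semicontinuity is automatic, as the norm is obtained from evaluations by suprema and \<open>\<ell>\<^sup>2\<close> sums.
\<close>

section \<open>Lower semicontinuous seminorms on spaces of bounded functions\<close>

text \<open>Seminorms are evaluated on arbitrary functions that are bounded on \<open>K\<close>, with the plain pointwise
  operations, and they ignore the values outside \<open>K\<close>. On a compact \<open>K\<close> this covers the continuous
  functions, and the restrictions to \<open>K\<close> only have to be dealt with in the last proof.\<close>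

definition bdd_on :: "'k set \<Rightarrow> ('k \<Rightarrow> real) set" where
  "bdd_on K = {f. \<exists>B. \<forall>x\<in>K. \<bar>f x\<bar> \<le> B}"

text \<open>The \<open>0\<close> in the supremum gives the right value for empty \<open>K\<close>.\<close>

definition unorm :: "'k set \<Rightarrow> ('k \<Rightarrow> real) \<Rightarrow> real" where
  "unorm K f = (SUP r\<in>insert 0 ((\<lambda>x. \<bar>f x\<bar>) ` K). r)"

text \<open>Homogeneity is required as an inequality because suprema preserve it for trivial reasons; applied
  to \<open>c\<close> and to \<open>1 / c\<close> it yields equality (\<open>seminorm_scale\<close>).\<close>

definition lsc_seminorm :: "'k set \<Rightarrow> real \<Rightarrow> (('k \<Rightarrow> real) \<Rightarrow> real) \<Rightarrow> bool" where
  "lsc_seminorm K C p \<longleftrightarrow>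
     (\<forall>f\<in>bdd_on K. 0 \<le> p f \<and> p f \<le> C * unorm K f) \<and>
     (\<forall>f\<in>bdd_on K. \<forall>c. p (\<lambda>x. c * f x) \<le> \<bar>c\<bar> * p f) \<and>
     (\<forall>f\<in>bdd_on K. \<forall>g\<in>bdd_on K. p (\<lambda>x. f x + g x) \<le> p f + p g) \<and>
     (\<forall>f. p (restrict f K) = p f) \<and>
     lower_semicontinuous_map (subtopology (pointwise_topology K) (bdd_on K)) p"

lemma bdd_on_scale: "f \<in> bdd_on K \<Longrightarrow> (\<lambda>x. c * f x) \<in> bdd_on K"
proof -
  assume "f \<in> bdd_on K"
  then obtain B where "\<forall>x\<in>K. \<bar>f x\<bar> \<le> B" by (auto simp: bdd_on_def)
  then have "\<forall>x\<in>K. \<bar>c * f x\<bar> \<le> \<bar>c\<bar> * B" by (simp add: abs_mult mult_left_mono)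
  then show ?thesis unfolding bdd_on_def by blast
qed

lemma bdd_on_add: "f \<in> bdd_on K \<Longrightarrow> g \<in> bdd_on K \<Longrightarrow> (\<lambda>x. f x + g x) \<in> bdd_on K"
  unfolding bdd_on_def
  by clarsimp (metis abs_triangle_ineq add_mono order_trans)

lemma bdd_on_midpoint:
  "f \<in> bdd_on K \<Longrightarrow> g \<in> bdd_on K \<Longrightarrow> (\<lambda>x. (1/2) * (f x + g x)) \<in> bdd_on K"
  by (intro bdd_on_scale bdd_on_add)

lemma bdd_above_unorm:
  assumes "f \<in> bdd_on K"
  shows "bdd_above (insert 0 ((\<lambda>x. \<bar>f x\<bar>) ` K))"
proof -
  obtain B where "\<forall>x\<in>K. \<bar>f x\<bar> \<le> B" using assms by (auto simp: bdd_on_def)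
  then show ?thesis by (auto intro!: bdd_aboveI[of _ "max 0 B"])
qed

lemma unorm_nonneg: "f \<in> bdd_on K \<Longrightarrow> 0 \<le> unorm K f"
  unfolding unorm_def image_ident by (rule cSup_upper[OF _ bdd_above_unorm]) auto

lemma abs_le_unorm: "f \<in> bdd_on K \<Longrightarrow> x \<in> K \<Longrightarrow> \<bar>f x\<bar> \<le> unorm K f"
  unfolding unorm_def image_ident by (rule cSup_upper[OF _ bdd_above_unorm]) auto

lemma unorm_le: "0 \<le> b \<Longrightarrow> (\<And>x. x \<in> K \<Longrightarrow> \<bar>f x\<bar> \<le> b) \<Longrightarrow> unorm K f \<le> b"
  unfolding unorm_def by (rule cSUP_least) auto

context
  fixes K :: "'k set" and C :: real and p :: "('k \<Rightarrow> real) \<Rightarrow> real"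
  assumes p: "lsc_seminorm K C p"
begin

lemma seminorm_nonneg: "f \<in> bdd_on K \<Longrightarrow> 0 \<le> p f"
  and seminorm_bound: "f \<in> bdd_on K \<Longrightarrow> p f \<le> C * unorm K f"
  and seminorm_scale_le: "f \<in> bdd_on K \<Longrightarrow> p (\<lambda>x. c * f x) \<le> \<bar>c\<bar> * p f"
  and seminorm_triangle:
    "f \<in> bdd_on K \<Longrightarrow> g \<in> bdd_on K \<Longrightarrow> p (\<lambda>x. f x + g x) \<le> p f + p g"
  and seminorm_restrict: "p (restrict f K) = p f"
  and seminorm_lsc: "lower_semicontinuous_map (subtopology (pointwise_topology K) (bdd_on K)) p"
  using p by (auto simp: lsc_seminorm_def)

lemma seminorm_scale:
  assumes f: "f \<in> bdd_on K"
  shows "p (\<lambda>x. c * f x) = \<bar>c\<bar> * p f"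
proof (cases "c = 0")
  case True
  then show ?thesis
    using seminorm_scale_le[OF f, of 0] seminorm_nonneg[OF bdd_on_scale[OF f, of 0]] by simp
next
  case False
  have "p f \<le> \<bar>1 / c\<bar> * p (\<lambda>x. c * f x)"
    using seminorm_scale_le[OF bdd_on_scale[OF f, of c], of "1 / c"] False by simp
  then have "\<bar>c\<bar> * p f \<le> p (\<lambda>x. c * f x)"
    using False by (simp add: field_simps)
  then show ?thesis using seminorm_scale_le[OF f, of c] by simp
qed

lemma seminorm_midpoint_le:
  assumes "f \<in> bdd_on K" "g \<in> bdd_on K"
  shows "p (\<lambda>x. (1/2) * (f x + g x)) \<le> (p f + p g) / 2"
  using seminorm_scale_le[OF bdd_on_add[OF assms], of "1/2"] seminorm_triangle[OF assms] by simp

end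

lemma lsc_seminorm_mono:
  assumes "lsc_seminorm K C p" "C \<le> C'"
  shows "lsc_seminorm K C' p"
proof -
  have "p f \<le> C' * unorm K f" if "f \<in> bdd_on K" for f
    using seminorm_bound[OF assms(1) that] mult_right_mono[OF assms(2) unorm_nonneg[OF that]]
    by linarith
  then show ?thesis using assms(1) by (auto simp: lsc_seminorm_def)
qed

subsection \<open>Lower semicontinuity\<close>

lemma lsc_ext:
  assumes "lower_semicontinuous_map X h" "\<And>x. x \<in> topspace X \<Longrightarrow> h' x = h x"
  shows "lower_semicontinuous_map X h'"
proof -
  have "{x \<in> topspace X. a < h' x} = {x \<in> topspace X. a < h x}" for a using assms(2) by auto
  then show ?thesis using assms(1) by (simp add: lower_semicontinuous_map_def)
qed

lemma lsc_SUP: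
  assumes "I \<noteq> {}" "\<And>i. i \<in> I \<Longrightarrow> lower_semicontinuous_map X (h i)"
    and bdd: "\<And>x. x \<in> topspace X \<Longrightarrow> bdd_above ((\<lambda>i. h i x) ` I)"
  shows "lower_semicontinuous_map X (\<lambda>x. SUP i\<in>I. h i x)"
  unfolding lower_semicontinuous_map_def
proof
  fix a
  have "{x \<in> topspace X. a < (SUP i\<in>I. h i x)} = (\<Union>i\<in>I. {x \<in> topspace X. a < h i x})"
    using less_cSUP_iff[OF assms(1) bdd] by auto
  moreover have "openin X \<dots>"
    by (rule openin_Union) (use assms(2) in \<open>auto simp: lower_semicontinuous_map_def\<close>)
  ultimately show "openin X {x \<in> topspace X. a < (SUP i\<in>I. h i x)}" by simp
qed

lemma lsc_const: "lower_semicontinuous_map X (\<lambda>_. c)"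
  unfolding lower_semicontinuous_map_def
proof
  fix a show "openin X {x \<in> topspace X. a < c}" by (cases "a < c") auto
qed

lemma lsc_continuous: "continuous_map X euclideanreal h \<Longrightarrow> lower_semicontinuous_map X h"
  unfolding lower_semicontinuous_map_def
  using openin_continuous_map_preimage[of X euclideanreal h "{_<..}"] by auto

lemma lsc_add:
  assumes "lower_semicontinuous_map X h" "lower_semicontinuous_map X k"
  shows "lower_semicontinuous_map X (\<lambda>x. h x + k x)"
  unfolding lower_semicontinuous_map_def
proof
  fix a
  have "{x \<in> topspace X. a < h x + k x}
      = (\<Union>u. {x \<in> topspace X. u < h x} \<inter> {x \<in> topspace X. a - u < k x})"
  proof (intro equalityI subsetI)
    fix x assume x: "x \<in> {x \<in> topspace X. a < h x + k x}"
    then obtain u where "a - k x < u" "u < h x" using dense[of "a - k x" "h x"] by auto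
    then show "x \<in> (\<Union>u. {x \<in> topspace X. u < h x} \<inter> {x \<in> topspace X. a - u < k x})"
      using x by auto
  qed auto
  moreover have "openin X \<dots>"
    by (rule openin_Union) (use assms in \<open>auto simp: lower_semicontinuous_map_def\<close>)
  ultimately show "openin X {x \<in> topspace X. a < h x + k x}" by simp
qed

lemma lsc_scale:
  assumes "lower_semicontinuous_map X h" "0 \<le> c"
  shows "lower_semicontinuous_map X (\<lambda>x. c * h x)"
proof (cases "c = 0")
  case True then show ?thesis by (simp add: lsc_const)
next
  case False
  then have "{x \<in> topspace X. a < c * h x} = {x \<in> topspace X. a / c < h x}" for a
    using assms(2) by (auto simp: field_simps)
  then show ?thesis using assms(1) by (simp add: lower_semicontinuous_map_def)
qed

lemma lsc_power2:
  assumes "lower_semicontinuous_map X h" "\<And>x. x \<in> topspace X \<Longrightarrow> 0 \<le> h x"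
  shows "lower_semicontinuous_map X (\<lambda>x. (h x)\<^sup>2)"
  unfolding lower_semicontinuous_map_def
proof
  fix a :: real
  show "openin X {x \<in> topspace X. a < (h x)\<^sup>2}"
  proof (cases "a < 0")
    case True
    then have "{x \<in> topspace X. a < (h x)\<^sup>2} = topspace X" by (auto intro: less_le_trans)
    then show ?thesis by simp
  next
    case False
    then have "{x \<in> topspace X. a < (h x)\<^sup>2} = {x \<in> topspace X. sqrt a < h x}"
      using assms(2) by (auto intro: real_less_lsqrt dest: real_less_rsqrt)
        (metis not_less real_le_lsqrt real_sqrt_le_iff real_sqrt_unique sqrt_le_D not_le)+
    then show ?thesis using assms(1) by (simp add: lower_semicontinuous_map_def)
  qed
qed

lemma lsc_sqrt:
  assumes "lower_semicontinuous_map X h" "\<And>x. x \<in> topspace X \<Longrightarrow> 0 \<le> h x"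
  shows "lower_semicontinuous_map X (\<lambda>x. sqrt (h x))"
  unfolding lower_semicontinuous_map_def
proof
  fix a :: real
  show "openin X {x \<in> topspace X. a < sqrt (h x)}"
  proof (cases "a < 0")
    case True
    then have "{x \<in> topspace X. a < sqrt (h x)} = topspace X"
      using assms(2) by (auto intro: less_le_trans)
    then show ?thesis by simp
  next
    case False
    then have "a < sqrt r \<longleftrightarrow> a\<^sup>2 < r" for r
      by (metis not_less real_sqrt_less_iff real_sqrt_unique)
    then show ?thesis using assms(1) by (simp add: lower_semicontinuous_map_def)
  qed
qed

lemma lsc_sum:
  assumes "finite I" "\<And>i. i \<in> I \<Longrightarrow> lower_semicontinuous_map X (h i)"
  shows "lower_semicontinuous_map X (\<lambda>x. \<Sum>i\<in>I. h i x)"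
  using assms by (induction) (auto simp: lsc_const lsc_add)

lemma lsc_suminf:
  assumes "\<And>i. lower_semicontinuous_map X (h i)"
    and "\<And>i x. x \<in> topspace X \<Longrightarrow> 0 \<le> h i x" "\<And>x. x \<in> topspace X \<Longrightarrow> summable (\<lambda>i. h i x)"
  shows "lower_semicontinuous_map X (\<lambda>x. \<Sum>i. h i x)"
proof (rule lsc_ext)
  have bdd: "bdd_above (range (\<lambda>n. \<Sum>i<n. h i x))" if "x \<in> topspace X" for x
    using sum_le_suminf[OF assms(3)[OF that]] assms(2)[OF that] by (auto intro!: bdd_aboveI)
  show "lower_semicontinuous_map X (\<lambda>x. SUP n. \<Sum>i<n. h i x)"
    by (rule lsc_SUP) (auto intro: lsc_sum assms bdd)
  show "(\<Sum>i. h i x) = (SUP n. \<Sum>i<n. h i x)" if "x \<in> topspace X" for x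
    by (rule suminf_eq_SUP_real) (use that assms in auto)
qed

subsection \<open>Operations on seminorms\<close>

lemma seminorm_SUP:
  assumes I: "I \<noteq> {}" and q: "\<And>i. i \<in> I \<Longrightarrow> lsc_seminorm K C (q i)"
  shows "lsc_seminorm K C (\<lambda>f. SUP i\<in>I. q i f)"
proof -
  have bdd: "bdd_above ((\<lambda>i. q i f) ` I)" if "f \<in> bdd_on K" for f
    using seminorm_bound[OF q that] by (auto intro!: bdd_aboveI)
  have le: "q i f \<le> (SUP i\<in>I. q i f)" if "f \<in> bdd_on K" "i \<in> I" for f i
    using cSUP_upper[OF that(2) bdd[OF that(1)]] .
  obtain i0 where i0: "i0 \<in> I" using I by auto
  have 1: "0 \<le> (SUP i\<in>I. q i f)" if "f \<in> bdd_on K" for f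
    using le[OF that i0] seminorm_nonneg[OF q[OF i0] that] by linarith
  have 2: "(SUP i\<in>I. q i f) \<le> C * unorm K f" if "f \<in> bdd_on K" for f
    using I seminorm_bound[OF q that] by (rule cSUP_least)
  have 3: "(SUP i\<in>I. q i (\<lambda>x. c * f x)) \<le> \<bar>c\<bar> * (SUP i\<in>I. q i f)" if f: "f \<in> bdd_on K" for f c
  proof (rule cSUP_least[OF I])
    fix i assume i: "i \<in> I"
    show "q i (\<lambda>x. c * f x) \<le> \<bar>c\<bar> * (SUP i\<in>I. q i f)"
      using seminorm_scale_le[OF q[OF i] f, of c] mult_left_mono[OF le[OF f i], of "\<bar>c\<bar>"] by simp
  qed
  have 4: "(SUP i\<in>I. q i (\<lambda>x. f x + g x)) \<le> (SUP i\<in>I. q i f) + (SUP i\<in>I. q i g)"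
    if f: "f \<in> bdd_on K" and g: "g \<in> bdd_on K" for f g
  proof (rule cSUP_least[OF I])
    fix i assume i: "i \<in> I"
    show "q i (\<lambda>x. f x + g x) \<le> (SUP i\<in>I. q i f) + (SUP i\<in>I. q i g)"
      using seminorm_triangle[OF q[OF i] f g] le[OF f i] le[OF g i] by linarith
  qed
  have 5: "(SUP i\<in>I. q i (restrict f K)) = (SUP i\<in>I. q i f)" for f
    using seminorm_restrict[OF q] by (auto intro: SUP_cong)
  have 6: "lower_semicontinuous_map (subtopology (pointwise_topology K) (bdd_on K))
      (\<lambda>f. SUP i\<in>I. q i f)"
    by (rule lsc_SUP[OF I]) (auto intro: seminorm_lsc q bdd)
  show ?thesis unfolding lsc_seminorm_def using 1 2 3 4 5 6 by auto
qed

text \<open>The sum is an \<open>\<ell>\<^sup>2\<close> norm of a sequence of seminorms, so the triangle inequality is Minkowski's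
  inequality for the partial sums. Lower semicontinuity holds because a series of nonnegative terms is the
  supremum of its partial sums.\<close>

lemma seminorm_series:
  assumes q: "\<And>n. lsc_seminorm K (C n) (q n)" and C: "summable (\<lambda>n. (C n)\<^sup>2)" "\<And>n. 0 \<le> C n"
  shows "lsc_seminorm K (sqrt (\<Sum>n. (C n)\<^sup>2)) (\<lambda>f. sqrt (\<Sum>n. (q n f)\<^sup>2))"
    and "f \<in> bdd_on K \<Longrightarrow> summable (\<lambda>n. (q n f)\<^sup>2)"
proof -
  have sq: "(q n f)\<^sup>2 \<le> (C n)\<^sup>2 * (unorm K f)\<^sup>2" if "f \<in> bdd_on K" for f n
    using power_mono[OF seminorm_bound[OF q that] seminorm_nonneg[OF q that], of n 2]
    by (simp add: power_mult_distrib)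
  show summ: "summable (\<lambda>n. (q n f)\<^sup>2)" if "f \<in> bdd_on K" for f
    by (rule summable_comparison_test'[OF summable_mult2[OF C(1), of "(unorm K f)\<^sup>2"]])
      (use sq[OF that] in auto)
  let ?p = "\<lambda>f. sqrt (\<Sum>n. (q n f)\<^sup>2)"
  have nonneg: "0 \<le> (\<Sum>n. (q n f)\<^sup>2)" if "f \<in> bdd_on K" for f
    using suminf_nonneg[OF summ[OF that]] by simp
  have bound: "?p f \<le> sqrt (\<Sum>n. (C n)\<^sup>2) * unorm K f" if f: "f \<in> bdd_on K" for f
  proof -
    have "(\<Sum>n. (q n f)\<^sup>2) \<le> (\<Sum>n. (C n)\<^sup>2 * (unorm K f)\<^sup>2)"
      by (rule suminf_le[OF sq[OF f] summ[OF f] summable_mult2[OF C(1)]])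
    also have "\<dots> = (\<Sum>n. (C n)\<^sup>2) * (unorm K f)\<^sup>2"
      using suminf_mult2[OF C(1)] by simp
    finally have "?p f \<le> sqrt ((\<Sum>n. (C n)\<^sup>2) * (unorm K f)\<^sup>2)" by simp
    then show ?thesis using unorm_nonneg[OF f] by (simp add: real_sqrt_mult)
  qed
  have scale: "?p (\<lambda>x. c * f x) \<le> \<bar>c\<bar> * ?p f" if f: "f \<in> bdd_on K" for f c
  proof -
    have "(\<Sum>n. (q n (\<lambda>x. c * f x))\<^sup>2) = (\<Sum>n. c\<^sup>2 * (q n f)\<^sup>2)"
      using seminorm_scale[OF q f] by (simp add: power_mult_distrib)
    also have "\<dots> = c\<^sup>2 * (\<Sum>n. (q n f)\<^sup>2)" by (rule suminf_mult[OF summ[OF f]])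
    finally show ?thesis by (simp add: real_sqrt_mult)
  qed
  have partial: "L2_set (\<lambda>n. q n f) {..<N} \<le> ?p f" if "f \<in> bdd_on K" for f N
    unfolding L2_set_def using sum_le_suminf[OF summ[OF that]] by simp
  have tri: "?p (\<lambda>x. f x + g x) \<le> ?p f + ?p g" if f: "f \<in> bdd_on K" and g: "g \<in> bdd_on K" for f g
  proof -
    have pn: "0 \<le> ?p f" "0 \<le> ?p g" using nonneg f g by auto
    have "(\<Sum>n. (q n (\<lambda>x. f x + g x))\<^sup>2) \<le> (?p f + ?p g)\<^sup>2"
    proof (rule suminf_le_const[OF summ[OF bdd_on_add[OF f g]]])
      fix N
      have "L2_set (\<lambda>n. q n (\<lambda>x. f x + g x)) {..<N} \<le> L2_set (\<lambda>n. q n f + q n g) {..<N}"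
        by (rule L2_set_mono)
          (auto intro: seminorm_triangle[OF q f g] seminorm_nonneg[OF q bdd_on_add[OF f g]])
      also have "\<dots> \<le> L2_set (\<lambda>n. q n f) {..<N} + L2_set (\<lambda>n. q n g) {..<N}"
        by (rule L2_set_triangle_ineq)
      also have "\<dots> \<le> ?p f + ?p g" using partial[OF f, of N] partial[OF g, of N] by linarith
      finally have "sqrt (\<Sum>n<N. (q n (\<lambda>x. f x + g x))\<^sup>2) \<le> ?p f + ?p g"
        by (simp add: L2_set_def)
      then show "(\<Sum>n<N. (q n (\<lambda>x. f x + g x))\<^sup>2) \<le> (?p f + ?p g)\<^sup>2"
        by (rule sqrt_le_D)
    qed
    then show ?thesis using pn by (intro real_le_lsqrt) auto
  qed
  have lsc: "lower_semicontinuous_map (subtopology (pointwise_topology K) (bdd_on K)) ?p"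
  proof (intro lsc_sqrt lsc_suminf lsc_power2)
    show "lower_semicontinuous_map (subtopology (pointwise_topology K) (bdd_on K)) (q n)" for n
      by (rule seminorm_lsc[OF q])
  qed (use seminorm_nonneg[OF q] summ nonneg in auto)
  show "lsc_seminorm K (sqrt (\<Sum>n. (C n)\<^sup>2)) ?p"
    unfolding lsc_seminorm_def
    using nonneg bound scale tri lsc seminorm_restrict[OF q] by simp
qed

lemma seminorm_mult:
  assumes p: "lsc_seminorm K C p" and c: "0 \<le> c"
  shows "lsc_seminorm K (c * C) (\<lambda>f. c * p f)"
  unfolding lsc_seminorm_def
proof (intro conjI ballI allI)
  fix f assume f: "f \<in> bdd_on K"
  show "0 \<le> c * p f" using seminorm_nonneg[OF p f] c by simp
  show "c * p f \<le> c * C * unorm K f" using mult_left_mono[OF seminorm_bound[OF p f] c] by simp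
  show "c * p (\<lambda>x. d * f x) \<le> \<bar>d\<bar> * (c * p f)" for d
    using seminorm_scale[OF p f] by simp
  show "c * p (\<lambda>x. f x + g x) \<le> c * p f + c * p g" if "g \<in> bdd_on K" for g
    using mult_left_mono[OF seminorm_triangle[OF p f that] c] by (simp add: algebra_simps)
next
  show "c * p (restrict f K) = c * p f" for f using seminorm_restrict[OF p] by simp
  show "lower_semicontinuous_map (subtopology (pointwise_topology K) (bdd_on K)) (\<lambda>f. c * p f)"
    by (rule lsc_scale[OF seminorm_lsc[OF p] c])
qed

lemma seminorm_zero: "0 \<le> C \<Longrightarrow> lsc_seminorm K C (\<lambda>_. 0)"
  by (simp add: lsc_seminorm_def unorm_nonneg lsc_const)

lemma seminorm_hypot:
  assumes p: "lsc_seminorm K C p" and q: "lsc_seminorm K C' q" and CC: "0 \<le> C" "0 \<le> C'" "0 \<le> c"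
  shows "lsc_seminorm K (sqrt (C\<^sup>2 + (c * C')\<^sup>2)) (\<lambda>f. sqrt ((p f)\<^sup>2 + (c * q f)\<^sup>2))"
proof -
  define Q where "Q = (\<lambda>n::nat. if n = 0 then p else if n = 1 then (\<lambda>f. c * q f) else (\<lambda>_. 0))"
  define D where "D = (\<lambda>n::nat. if n = 0 then C else if n = 1 then c * C' else 0)"
  have Q: "lsc_seminorm K (D n) (Q n)" for n
    using p seminorm_mult[OF q CC(3)] seminorm_zero[of 0 K] by (auto simp: Q_def D_def)
  have *: "(\<Sum>n. (F n)\<^sup>2) = (F 0)\<^sup>2 + (F 1)\<^sup>2" and s: "summable (\<lambda>n. (F n)\<^sup>2)"
    if "\<And>n. n > 1 \<Longrightarrow> F n = 0" for F :: "nat \<Rightarrow> real"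
    using suminf_finite[of "{0,1}" "\<lambda>n. (F n)\<^sup>2"] summable_finite[of "{0,1}" "\<lambda>n. (F n)\<^sup>2"] that
    by (auto simp: less_Suc_eq)
  have D: "summable (\<lambda>n. (D n)\<^sup>2)" "\<And>n. 0 \<le> D n"
    using s[of D] CC by (auto simp: D_def)
  show ?thesis
    using seminorm_series(1)[OF Q D] *[of D] *[of "\<lambda>n. Q n _"] by (simp add: D_def Q_def)
qed

lemma seminorm_eval:
  assumes "s \<in> K" "t \<in> K" "\<bar>a\<bar> \<le> 1"
  shows "lsc_seminorm K 2 (\<lambda>f. \<bar>f s + a * f t\<bar>)"
  unfolding lsc_seminorm_def
proof (intro conjI ballI allI)
  fix f assume f: "f \<in> bdd_on K"
  have "\<bar>a * f t\<bar> \<le> \<bar>f t\<bar>" using mult_right_mono[OF assms(3), of "\<bar>f t\<bar>"] by (simp add: abs_mult)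
  then show "\<bar>f s + a * f t\<bar> \<le> 2 * unorm K f"
    using abs_le_unorm[OF f assms(1)] abs_le_unorm[OF f assms(2)] by linarith
  show "\<bar>c * f s + a * (c * f t)\<bar> \<le> \<bar>c\<bar> * \<bar>f s + a * f t\<bar>" for c
    by (simp add: abs_mult[symmetric] algebra_simps)
  show "\<bar>f s + g s + a * (f t + g t)\<bar> \<le> \<bar>f s + a * f t\<bar> + \<bar>g s + a * g t\<bar>" for g
    using abs_triangle_ineq[of "f s + a * f t" "g s + a * g t"] by (simp add: algebra_simps)
next
  show "lower_semicontinuous_map (subtopology (pointwise_topology K) (bdd_on K))
      (\<lambda>f. \<bar>f s + a * f t\<bar>)"
    by (rule lsc_continuous, rule continuous_map_from_subtopology)
      (intro continuous_map_real_abs continuous_map_add continuous_map_real_mult_left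
        continuous_map_product_projection assms)
qed (use assms in auto)

text \<open>The building blocks: \<open>a = -1\<close> measures how far \<open>f\<close> separates the pairs in \<open>S\<close>, and \<open>a = 1\<close> recovers,
  on a set where \<open>f\<close> is almost constant, the size of \<open>f\<close>. The zero seminorm takes care of \<open>S = {}\<close>.\<close>

definition pair_seminorm :: "real \<Rightarrow> ('k \<times> 'k) set \<Rightarrow> ('k \<Rightarrow> real) \<Rightarrow> real" where
  "pair_seminorm a S f = (SUP p\<in>insert (\<lambda>_. 0) ((\<lambda>(s, t) f. \<bar>f s + a * f t\<bar>) ` S). p f)"

lemma pair_seminorm:
  assumes "S \<subseteq> K \<times> K" "\<bar>a\<bar> \<le> 1"
  shows "lsc_seminorm K 2 (pair_seminorm a S)"
  unfolding pair_seminorm_def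
  by (rule seminorm_SUP) (use assms seminorm_zero[of 2 K] in \<open>auto intro!: seminorm_eval\<close>)

lemma pair_seminorm_ge:
  assumes "S \<subseteq> K \<times> K" "\<bar>a\<bar> \<le> 1" "f \<in> bdd_on K" "(s, t) \<in> S"
  shows "\<bar>f s + a * f t\<bar> \<le> pair_seminorm a S f"
proof -
  have p: "lsc_seminorm K 2 p" if "p \<in> insert (\<lambda>_. 0) ((\<lambda>(s, t) f. \<bar>f s + a * f t\<bar>) ` S)" for p
    using that assms seminorm_zero[of 2 K] by (auto intro!: seminorm_eval)
  have "bdd_above ((\<lambda>p. p f) ` insert (\<lambda>_. 0) ((\<lambda>(s, t) f. \<bar>f s + a * f t\<bar>) ` S))"
    using seminorm_bound[OF p assms(3)] by (intro bdd_aboveI2)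
  note bdd = this
  have "(\<lambda>f. \<bar>f s + a * f t\<bar>) \<in> (\<lambda>(s, t) f. \<bar>f s + a * f t\<bar>) ` S"
    using assms(4) by (rule rev_image_eqI) simp
  from cSUP_upper[OF insertI2[OF this] bdd] show ?thesis unfolding pair_seminorm_def .
qed

lemma pair_seminorm_le:
  assumes "0 \<le> b" "\<And>s t. (s, t) \<in> S \<Longrightarrow> \<bar>f s + a * f t\<bar> \<le> b"
  shows "pair_seminorm a S f \<le> b"
  unfolding pair_seminorm_def by (rule cSUP_least) (use assms in auto)

section \<open>Midpoint convergence\<close>

text \<open>This is the hypothesis in the definition of local uniform rotundity, for a seminorm. The construction
  rests on passing it from a norm to the seminorms from which the norm is built.\<close>

definition midpoint_conv :: "(('k \<Rightarrow> real) \<Rightarrow> real) \<Rightarrow> ('k \<Rightarrow> real) \<Rightarrow> (nat \<Rightarrow> 'k \<Rightarrow> real) \<Rightarrow> bool" where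
  "midpoint_conv p f g \<longleftrightarrow>
     (\<lambda>n. p (g n)) \<longlonglongrightarrow> p f \<and> (\<lambda>n. p (\<lambda>x. (1/2) * (f x + g n x))) \<longlonglongrightarrow> p f"

text \<open>For a seminorm this is nonnegative, and it is additive over sums of squares. Midpoint convergence says
  exactly that it tends to \<open>0\<close>, which is why midpoint convergence of a square root of a sum of squares is
  inherited by each summand.\<close>

definition parallelogram_gap :: "(('k \<Rightarrow> real) \<Rightarrow> real) \<Rightarrow> ('k \<Rightarrow> real) \<Rightarrow> ('k \<Rightarrow> real) \<Rightarrow> real" where
  "parallelogram_gap p f h = ((p f)\<^sup>2 + (p h)\<^sup>2) / 2 - (p (\<lambda>x. (1/2) * (f x + h x)))\<^sup>2"

lemma parallelogram_gap_ge:
  assumes p: "lsc_seminorm K C p" and f: "f \<in> bdd_on K" and h: "h \<in> bdd_on K"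
  shows "((p f - p h) / 2)\<^sup>2 \<le> parallelogram_gap p f h"
proof -
  have "(p (\<lambda>x. (1/2) * (f x + h x)))\<^sup>2 \<le> ((p f + p h) / 2)\<^sup>2"
    by (rule power_mono[OF seminorm_midpoint_le[OF p f h] seminorm_nonneg[OF p bdd_on_midpoint[OF f h]]])
  then show ?thesis
    unfolding parallelogram_gap_def by (simp add: power2_eq_square field_simps)
qed

lemma parallelogram_gap_nonneg:
  assumes "lsc_seminorm K C p" "f \<in> bdd_on K" "h \<in> bdd_on K"
  shows "0 \<le> parallelogram_gap p f h"
  using parallelogram_gap_ge[OF assms] by (meson order_trans zero_le_power2)

lemma midpoint_conv_iff_gap:
  assumes p: "lsc_seminorm K C p" and f: "f \<in> bdd_on K" and g: "\<And>n. g n \<in> bdd_on K"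
  shows "midpoint_conv p f g \<longleftrightarrow> (\<lambda>n. parallelogram_gap p f (g n)) \<longlonglongrightarrow> 0"
proof
  assume "midpoint_conv p f g"
  then have "(\<lambda>n. ((p f)\<^sup>2 + (p (g n))\<^sup>2) / 2 - (p (\<lambda>x. (1/2) * (f x + g n x)))\<^sup>2)
      \<longlonglongrightarrow> ((p f)\<^sup>2 + (p f)\<^sup>2) / 2 - (p f)\<^sup>2"
    unfolding midpoint_conv_def by (intro tendsto_intros) auto
  then show "(\<lambda>n. parallelogram_gap p f (g n)) \<longlonglongrightarrow> 0"
    by (simp add: parallelogram_gap_def)
next
  assume gap: "(\<lambda>n. parallelogram_gap p f (g n)) \<longlonglongrightarrow> 0"
  have "(\<lambda>n. ((p f - p (g n)) / 2)\<^sup>2) \<longlonglongrightarrow> 0"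
    by (rule tendsto_sandwich[OF _ _ tendsto_const gap])
      (use parallelogram_gap_ge[OF p f g] in auto)
  from tendsto_real_sqrt[OF this] have "(\<lambda>n. \<bar>(p f - p (g n)) / 2\<bar>) \<longlonglongrightarrow> 0" by simp
  then have "(\<lambda>n. (p f - p (g n)) / 2) \<longlonglongrightarrow> 0" by (rule tendsto_rabs_zero_cancel)
  from tendsto_diff[OF tendsto_const[of "p f"] tendsto_mult_left[OF this, of 2]]
  have 1: "(\<lambda>n. p (g n)) \<longlonglongrightarrow> p f" by (simp add: field_simps)
  have "(\<lambda>n. ((p f)\<^sup>2 + (p (g n))\<^sup>2) / 2 - parallelogram_gap p f (g n))
      \<longlonglongrightarrow> ((p f)\<^sup>2 + (p f)\<^sup>2) / 2 - 0"
    by (intro tendsto_intros 1 gap) auto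
  then have "(\<lambda>n. (p (\<lambda>x. (1/2) * (f x + g n x)))\<^sup>2) \<longlonglongrightarrow> (p f)\<^sup>2"
    by (simp add: parallelogram_gap_def)
  from tendsto_real_sqrt[OF this] have "(\<lambda>n. p (\<lambda>x. (1/2) * (f x + g n x))) \<longlonglongrightarrow> p f"
    using seminorm_nonneg[OF p f] seminorm_nonneg[OF p bdd_on_midpoint[OF f g]] by simp
  with 1 show "midpoint_conv p f g" by (simp add: midpoint_conv_def)
qed

lemma midpoint_conv_gap_le:
  assumes P: "lsc_seminorm K C P" and q: "lsc_seminorm K C' q"
    and f: "f \<in> bdd_on K" and g: "\<And>n. g n \<in> bdd_on K" and k: "k > 0"
    and le: "\<And>h. h \<in> bdd_on K \<Longrightarrow> k * parallelogram_gap q f h \<le> parallelogram_gap P f h"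
    and conv: "midpoint_conv P f g"
  shows "midpoint_conv q f g"
proof -
  have gap: "(\<lambda>n. parallelogram_gap P f (g n) / k) \<longlonglongrightarrow> 0"
    using tendsto_divide[OF conv[unfolded midpoint_conv_iff_gap[OF P f g]] tendsto_const[of k]] k
    by simp
  have "(\<lambda>n. parallelogram_gap q f (g n)) \<longlonglongrightarrow> 0"
    by (rule tendsto_sandwich[OF _ _ tendsto_const gap])
      (use parallelogram_gap_nonneg[OF q f g] le[OF g] k in \<open>auto simp: field_simps\<close>)
  then show ?thesis by (simp add: midpoint_conv_iff_gap[OF q f g])
qed

lemma midpoint_conv_series:
  assumes q: "\<And>n. lsc_seminorm K (C n) (q n)" and C: "summable (\<lambda>n. (C n)\<^sup>2)" "\<And>n. 0 \<le> C n"
    and f: "f \<in> bdd_on K" and g: "\<And>n. g n \<in> bdd_on K"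
    and conv: "midpoint_conv (\<lambda>f. sqrt (\<Sum>n. (q n f)\<^sup>2)) f g"
  shows "midpoint_conv (q m) f g"
proof (rule midpoint_conv_gap_le[OF seminorm_series(1)[OF q C] q f g _ _ conv])
  fix h assume h: "h \<in> bdd_on K"
  note s = seminorm_series(2)[OF q C]
  note sf = sums_add[OF summable_sums[OF s[OF f]] summable_sums[OF s[OF h]]]
  have sq: "(sqrt (\<Sum>n. (q n u)\<^sup>2))\<^sup>2 = (\<Sum>n. (q n u)\<^sup>2)" if "u \<in> bdd_on K" for u
    using suminf_nonneg[OF s[OF that]] by simp
  have sums: "(\<lambda>n. parallelogram_gap (q n) f h) sums
      parallelogram_gap (\<lambda>f. sqrt (\<Sum>n. (q n f)\<^sup>2)) f h"
    unfolding parallelogram_gap_def sq[OF f] sq[OF h] sq[OF bdd_on_midpoint[OF f h]]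
    by (rule sums_diff[OF sums_divide[OF sf] summable_sums[OF s[OF bdd_on_midpoint[OF f h]]]])
  have "sum (\<lambda>n. parallelogram_gap (q n) f h) {m} \<le> (\<Sum>n. parallelogram_gap (q n) f h)"
    by (rule sum_le_suminf[OF sums_summable[OF sums]]) (auto intro: parallelogram_gap_nonneg[OF q f h])
  then show "1 * parallelogram_gap (q m) f h
      \<le> parallelogram_gap (\<lambda>f. sqrt (\<Sum>n. (q n f)\<^sup>2)) f h"
    using sums_unique[OF sums] by simp
qed auto

lemma midpoint_conv_hypot:
  assumes p: "lsc_seminorm K C p" and q: "lsc_seminorm K C' q"
    and c: "0 \<le> C" "0 \<le> C'" "0 < c"
    and f: "f \<in> bdd_on K" and g: "\<And>n. g n \<in> bdd_on K"
    and conv: "midpoint_conv (\<lambda>f. sqrt ((p f)\<^sup>2 + (c * q f)\<^sup>2)) f g"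
  shows "midpoint_conv q f g"
proof (rule midpoint_conv_gap_le[OF seminorm_hypot[OF p q c(1,2) less_imp_le[OF c(3)]] q f g _ _ conv])
  show "c\<^sup>2 > 0" using c by simp
  fix h assume h: "h \<in> bdd_on K"
  have "parallelogram_gap (\<lambda>f. sqrt ((p f)\<^sup>2 + (c * q f)\<^sup>2)) f h
      = parallelogram_gap p f h + c\<^sup>2 * parallelogram_gap q f h"
    by (simp add: parallelogram_gap_def power_mult_distrib algebra_simps add_divide_distrib)
  then show "c\<^sup>2 * parallelogram_gap q f h
      \<le> parallelogram_gap (\<lambda>f. sqrt ((p f)\<^sup>2 + (c * q f)\<^sup>2)) f h"
    using parallelogram_gap_nonneg[OF p f h] by simp
qed

text \<open>A simple form of Deville's lemma. A seminorm that nearly attains the supremum at the midpoint of \<open>f\<close> and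
  \<open>g n\<close> must nearly attain it at \<open>f\<close>, by convexity. When only the index \<open>i0\<close> does so at \<open>f\<close>, the supremum
  at the midpoints is eventually given by \<open>i0\<close>.\<close>

lemma midpoint_conv_SUP:
  assumes q: "\<And>i. i \<in> I \<Longrightarrow> lsc_seminorm K C (q i)" and i0: "i0 \<in> I"
    and f: "f \<in> bdd_on K" and g: "\<And>n. g n \<in> bdd_on K"
    and c: "c < q i0 f" and other: "\<And>i. i \<in> I \<Longrightarrow> i \<noteq> i0 \<Longrightarrow> q i f \<le> c"
    and conv: "midpoint_conv (\<lambda>f. SUP i\<in>I. q i f) f g"
  shows "midpoint_conv (q i0) f g"
proof -
  define p where "p = (\<lambda>f. SUP i\<in>I. q i f)"
  define mid where "mid = (\<lambda>n x. (1/2) * (f x + g n x))"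
  have mid: "mid n \<in> bdd_on K" for n unfolding mid_def by (rule bdd_on_midpoint[OF f g])
  have I: "I \<noteq> {}" using i0 by auto
  have le: "q i u \<le> p u" if "u \<in> bdd_on K" "i \<in> I" for u i
    unfolding p_def
    by (rule cSUP_upper[OF that(2)], rule bdd_aboveI2, rule seminorm_bound[OF q that(1)])
  have pf: "p f = q i0 f"
  proof (rule antisym)
    show "p f \<le> q i0 f" unfolding p_def
      by (rule cSUP_least[OF I]) (use other c in \<open>metis order.refl less_imp_le order_trans\<close>)
  qed (rule le[OF f i0])
  have lim: "(\<lambda>n. p (g n)) \<longlonglongrightarrow> p f" "(\<lambda>n. p (mid n)) \<longlonglongrightarrow> p f"
    using conv by (auto simp: midpoint_conv_def p_def mid_def)
  \<comment> \<open>At the midpoints the other seminorms stay below the average of \<open>c\<close> and \<open>p (g n)\<close>.\<close>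
  have half: "q i (mid n) \<le> (q i f + q i (g n)) / 2" if "i \<in> I" for i n
    unfolding mid_def by (rule seminorm_midpoint_le[OF q[OF that] f g])
  have "(\<lambda>n. p (mid n) - (c + p (g n)) / 2) \<longlonglongrightarrow> p f - (c + p f) / 2"
    by (intro tendsto_intros lim) auto
  then have "\<forall>\<^sub>F n in sequentially. 0 < p (mid n) - (c + p (g n)) / 2"
    by (rule order_tendstoD) (use c pf in auto)
  then have ev: "\<forall>\<^sub>F n in sequentially. q i0 (mid n) = p (mid n)"
  proof eventually_elim
    case (elim n)
    have "p (mid n) \<le> max (q i0 (mid n)) ((c + p (g n)) / 2)" unfolding p_def
    proof (rule cSUP_least[OF I])
      fix i assume i: "i \<in> I"
      have "q i (mid n) \<le> (c + p (g n)) / 2" if "i \<noteq> i0"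
      proof -
        have "q i f + q i (g n) \<le> c + p (g n)" using other[OF i that] le[OF g i] by (rule add_mono)
        then show ?thesis using half[OF i, of n] by simp
      qed
      then show "q i (mid n) \<le> max (q i0 (mid n)) ((c + (SUP i\<in>I. q i (g n))) / 2)"
        unfolding p_def by (cases "i = i0") (auto simp: le_max_iff_disj)
    qed
    then show ?case using elim le[OF mid i0, of n] by linarith
  qed
  have m0: "(\<lambda>n. q i0 (mid n)) \<longlonglongrightarrow> q i0 f"
    using lim(2) tendsto_cong[OF ev] pf by simp
  have "(\<lambda>n. 2 * q i0 (mid n) - q i0 f) \<longlonglongrightarrow> 2 * q i0 f - q i0 f"
    by (intro tendsto_intros m0)
  then have low: "(\<lambda>n. 2 * q i0 (mid n) - q i0 f) \<longlonglongrightarrow> q i0 f" by simp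
  have "(\<lambda>n. q i0 (g n)) \<longlonglongrightarrow> q i0 f"
    by (rule tendsto_sandwich[OF _ _ low lim(1)[unfolded pf]])
      (use half[OF i0] le[OF g i0] in \<open>auto intro!: always_eventually simp: field_simps\<close>)
  then show ?thesis using m0 by (simp add: midpoint_conv_def mid_def)
qed

text \<open>The weighted \<open>\<ell>\<^sup>2\<close> sum of the uniform norm and of all members of \<open>\<F>\<close>; the weights make the series converge
  on bounded functions.\<close>

lemma countable_seminorms_combine:
  assumes count: "countable \<F>" and \<F>: "\<And>p. p \<in> \<F> \<Longrightarrow> \<exists>C. lsc_seminorm K C p"
  obtains \<nu> where "lsc_seminorm K 2 \<nu>" "\<And>f. f \<in> bdd_on K \<Longrightarrow> unorm K f \<le> \<nu> f"
    "\<And>f g p. f \<in> bdd_on K \<Longrightarrow> (\<forall>n. g n \<in> bdd_on K) \<Longrightarrow> midpoint_conv \<nu> f g \<Longrightarrow> p \<in> \<F>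
       \<Longrightarrow> midpoint_conv p f g"
proof -
  have unorm: "lsc_seminorm K 1 (unorm K)"
  proof -
    have eq: "unorm K = (\<lambda>f. SUP p\<in>insert (\<lambda>_. 0) ((\<lambda>x f. \<bar>f x\<bar>) ` K). p f)"
      by (rule ext) (simp add: unorm_def image_image)
    have "lsc_seminorm K 1 (\<lambda>f. \<bar>f x\<bar>)" if x: "x \<in> K" for x
      using seminorm_eval[OF x x, of 0] abs_le_unorm[OF _ x] by (simp add: lsc_seminorm_def)
    then show ?thesis unfolding eq
      by (intro seminorm_SUP) (auto intro: seminorm_zero)
  qed
  define P where "P = from_nat_into (insert (unorm K) \<F>)"
  have rangeP: "range P = insert (unorm K) \<F>" unfolding P_def
    by (rule range_from_nat_into) (use count in auto)
  have "\<exists>C\<ge>1. lsc_seminorm K C (P n)" for n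
  proof -
    have "P n \<in> insert (unorm K) \<F>" using rangeP by auto
    then obtain C where "lsc_seminorm K C (P n)" using \<F> unorm by auto
    then have "lsc_seminorm K (max C 1) (P n)" by (rule lsc_seminorm_mono) simp
    then show ?thesis by (intro exI[of _ "max C 1"]) auto
  qed
  then obtain B where B: "\<And>n. B n \<ge> 1" "\<And>n. lsc_seminorm K (B n) (P n)" by metis
  define w where "w = (\<lambda>n. case n of 0 \<Rightarrow> 1 | Suc m \<Rightarrow> sqrt ((1/2) ^ n) / B m)"
  define Q where "Q = (\<lambda>n. case n of 0 \<Rightarrow> unorm K | Suc m \<Rightarrow> P m)"
  have Bpos: "B n > 0" for n using B(1)[of n] by linarith
  have w: "w n > 0" for n using Bpos by (auto simp: w_def split: nat.splits)
  define C where "C = (\<lambda>n. sqrt ((1/2) ^ n) :: real)"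
  have Q: "lsc_seminorm K (C n) (\<lambda>f. w n * Q n f)" for n
  proof (cases n)
    case 0 then show ?thesis using unorm by (simp add: w_def Q_def C_def)
  next
    case (Suc m)
    have "B m \<noteq> 0" using B(1)[of m] by auto
    then show ?thesis using seminorm_mult[OF B(2)[of m], of "w n"] w[of n] Suc
      by (simp add: w_def Q_def C_def)
  qed
  have C2: "(\<lambda>n. (C n)\<^sup>2) = (\<lambda>n. (1/2) ^ n)" by (simp add: C_def)
  have C: "summable (\<lambda>n. (C n)\<^sup>2)" "\<And>n. 0 \<le> C n" unfolding C2 by (auto simp: C_def)
  have sumC: "(\<Sum>n. (C n)\<^sup>2) = 2" unfolding C2 by (subst suminf_geometric) auto
  define \<nu> where "\<nu> = (\<lambda>f. sqrt (\<Sum>n. (w n * Q n f)\<^sup>2))"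
  show ?thesis
  proof
    have "sqrt 2 \<le> (2::real)" by (rule real_le_lsqrt) auto
    then show "lsc_seminorm K 2 \<nu>"
      unfolding \<nu>_def by (rule lsc_seminorm_mono[OF seminorm_series(1)[OF Q C, unfolded sumC]])
    show "unorm K f \<le> \<nu> f" if f: "f \<in> bdd_on K" for f
    proof -
      have "sum (\<lambda>n. (w n * Q n f)\<^sup>2) {0} \<le> (\<Sum>n. (w n * Q n f)\<^sup>2)"
        by (rule sum_le_suminf[OF seminorm_series(2)[OF Q C f]]) auto
      then show ?thesis unfolding \<nu>_def by (intro real_le_rsqrt) (simp add: w_def Q_def)
    qed
    fix f g p
    assume f: "f \<in> bdd_on K" and g: "\<forall>n. g n \<in> bdd_on K" and conv: "midpoint_conv \<nu> f g"
      and p: "p \<in> \<F>"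
    then obtain m where m: "p = P m" using rangeP by (metis image_iff insertI2)
    have "midpoint_conv (\<lambda>f. w (Suc m) * Q (Suc m) f) f g"
      by (rule midpoint_conv_series[OF Q C f g[rule_format] conv[unfolded \<nu>_def]])
    then have conv': "(\<lambda>n. w (Suc m) * p (g n)) \<longlonglongrightarrow> w (Suc m) * p f"
      "(\<lambda>n. w (Suc m) * p (\<lambda>x. (1/2) * (f x + g n x))) \<longlonglongrightarrow> w (Suc m) * p f"
      unfolding midpoint_conv_def m by (simp_all add: Q_def)
    have cancel: "X \<longlonglongrightarrow> L" if "(\<lambda>n. w (Suc m) * X n) \<longlonglongrightarrow> w (Suc m) * L" for X :: "nat \<Rightarrow> real" and L
    proof -
      have "(\<lambda>n. w (Suc m) * X n / w (Suc m)) \<longlonglongrightarrow> w (Suc m) * L / w (Suc m)"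
        by (rule tendsto_divide[OF that tendsto_const]) (use w[of "Suc m"] in simp)
      then show ?thesis using w[of "Suc m"] by simp
    qed
    show "midpoint_conv p f g"
      unfolding midpoint_conv_def using cancel[OF conv'(1)] cancel[OF conv'(2)] by blast
  qed
qed

section \<open>Towers of suprema\<close>

text \<open>A tower is a seminorm that reveals control points level by level. On a level \<open>(S, m, k)\<close>, with the set
  \<open>M\<close> already revealed, the pairs \<open>S M N\<close> reward the right choice of at most \<open>m\<close> new points \<open>N\<close>; for large
  \<open>k\<close> the remaining levels are so light that they cannot change the maximising \<open>N\<close>. At the bottom, \<open>b\<close> may
  use all the points that were found.\<close>

primrec tower :: "(('a set \<Rightarrow> 'a set \<Rightarrow> ('k \<times> 'k) set) \<times> nat \<times> nat) list
    \<Rightarrow> ('a set \<Rightarrow> ('k \<Rightarrow> real) \<Rightarrow> real) \<Rightarrow> 'a set \<Rightarrow> ('k \<Rightarrow> real) \<Rightarrow> real" where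
  "tower [] b M f = b M f"
| "tower (l # ls) b M f = (case l of (S, m, k) \<Rightarrow>
     SUP N\<in>{N. finite N \<and> card N \<le> m}.
       sqrt ((pair_seminorm (-1) (S M N) f)\<^sup>2 + ((1/2) ^ k * tower ls b (M \<union> N) f)\<^sup>2))"

lemma tower_level_seminorm:
  assumes "S \<subseteq> K \<times> K" "lsc_seminorm K C p" "2 \<le> C"
  shows "lsc_seminorm K (2 * C) (\<lambda>f. sqrt ((pair_seminorm (-1) S f)\<^sup>2 + ((1/2) ^ k * p f)\<^sup>2))"
proof (rule lsc_seminorm_mono[OF seminorm_hypot[OF pair_seminorm[OF assms(1)] assms(2)]])
  have "((1/2) ^ k * C)\<^sup>2 \<le> C\<^sup>2"
    using assms(3) by (intro power_mono mult_left_le_one_le power_le_one) auto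
  moreover have "2\<^sup>2 \<le> C\<^sup>2" using assms(3) by (intro power_mono) auto
  ultimately have "2\<^sup>2 + ((1/2) ^ k * C)\<^sup>2 \<le> (2 * C)\<^sup>2" by (simp add: power_mult_distrib)
  then show "sqrt (2\<^sup>2 + ((1/2) ^ k * C)\<^sup>2) \<le> 2 * C" using assms(3) by (intro real_le_lsqrt) auto
qed (use assms in auto)

lemma tower_seminorm:
  assumes "\<And>M. lsc_seminorm K 2 (b M)" "\<And>S M N. S \<in> fst ` set ls \<Longrightarrow> S M N \<subseteq> K \<times> K"
  shows "lsc_seminorm K (2 ^ Suc (length ls)) (tower ls b M)"
  using assms(2)
proof (induction ls arbitrary: M)
  case Nil
  have "tower [] b M = b M" by (rule ext) simp
  then show ?case using assms(1) by simp
next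
  case (Cons l ls)
  obtain S m k where l: "l = (S, m, k)" by (cases l)
  have "(2::real) \<le> 2 ^ Suc (length ls)" by (simp add: one_le_power)
  then have "lsc_seminorm K (2 * 2 ^ Suc (length ls))
      (\<lambda>f. SUP N\<in>{N. finite N \<and> card N \<le> m}.
        sqrt ((pair_seminorm (-1) (S M N) f)\<^sup>2 + ((1/2) ^ k * tower ls b (M \<union> N) f)\<^sup>2))"
    using Cons l by (intro seminorm_SUP tower_level_seminorm) (auto intro: exI[of _ "{}"])
  moreover have "tower (l # ls) b M = (\<lambda>f. SUP N\<in>{N. finite N \<and> card N \<le> m}.
        sqrt ((pair_seminorm (-1) (S M N) f)\<^sup>2 + ((1/2) ^ k * tower ls b (M \<union> N) f)\<^sup>2))"
    by (rule ext) (simp add: l)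
  ultimately show ?case by simp
qed

text \<open>The exponent \<open>k\<close> depends on \<open>f\<close> (this is why all exponents occur in the norm): the lower levels contribute at
  most \<open>(1/2) ^ k\<close> times a constant, which has to be smaller than the advantage of \<open>N0\<close> over the other
  choices. Then \<open>N0\<close> is the unique near-maximiser, and convergence passes first to its term and
  then to the second square in it.\<close>

lemma tower_descend:
  assumes S: "\<And>M N. S M N \<subseteq> K \<times> K" and ls: "\<And>S M N. S \<in> fst ` set ls \<Longrightarrow> S M N \<subseteq> K \<times> K"
    and f: "f \<in> bdd_on K" and N0: "finite N0" "card N0 \<le> m" and e: "0 \<le> e"
    and large: "e < pair_seminorm (-1) (S M N0) f"
    and small: "\<And>N. finite N \<Longrightarrow> card N \<le> m \<Longrightarrow> N \<noteq> N0 \<Longrightarrow> pair_seminorm (-1) (S M N) f \<le> e"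
  shows "\<exists>k. \<forall>b g. (\<forall>M. lsc_seminorm K 2 (b M)) \<longrightarrow> (\<forall>n. g n \<in> bdd_on K) \<longrightarrow>
     midpoint_conv (tower ((S, m, k) # ls) b M) f g \<longrightarrow> midpoint_conv (tower ls b (M \<union> N0)) f g"
proof -
  define C where "C = (2::real) ^ Suc (length ls)"
  have C: "2 \<le> C" unfolding C_def by (simp add: one_le_power)
  define c where "c = pair_seminorm (-1) (S M N0) f"
  have "e\<^sup>2 < c\<^sup>2" using large e unfolding c_def by (simp add: power_strict_mono)
  then have pos: "0 < sqrt (c\<^sup>2 - e\<^sup>2) / (C * unorm K f + 1)"
    using C unorm_nonneg[OF f] by (auto intro!: divide_pos_pos add_nonneg_pos mult_nonneg_nonneg)
  obtain k where k: "(1/2) ^ k < sqrt (c\<^sup>2 - e\<^sup>2) / (C * unorm K f + 1)"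
    using real_arch_pow_inv[OF pos, of "1/2"] by auto
  have "(1/2) ^ k * (C * unorm K f) \<le> (1/2) ^ k * (C * unorm K f + 1)" by simp
  also have "\<dots> < sqrt (c\<^sup>2 - e\<^sup>2)"
    using k C unorm_nonneg[OF f] by (subst (asm) pos_less_divide_eq) (auto intro!: add_nonneg_pos)
  finally have "((1/2) ^ k * (C * unorm K f))\<^sup>2 < (sqrt (c\<^sup>2 - e\<^sup>2))\<^sup>2"
    using C unorm_nonneg[OF f] by (intro power_strict_mono) auto
  then have kk: "e\<^sup>2 + ((1/2) ^ k * (C * unorm K f))\<^sup>2 < c\<^sup>2" using \<open>e\<^sup>2 < c\<^sup>2\<close> by simp
  show ?thesis
  proof (intro exI[of _ k] allI impI)
    fix b g
    assume b: "\<forall>M. lsc_seminorm K 2 (b M)" and g: "\<forall>n. g n \<in> bdd_on K"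
      and conv: "midpoint_conv (tower ((S, m, k) # ls) b M) f g"
    define q where "q = (\<lambda>N f. sqrt ((pair_seminorm (-1) (S M N) f)\<^sup>2
        + ((1/2) ^ k * tower ls b (M \<union> N) f)\<^sup>2))"
    have tw: "lsc_seminorm K C (tower ls b M)" for M
      unfolding C_def by (rule tower_seminorm) (use b ls in auto)
    have q: "lsc_seminorm K (2 * C) (q N)" for N
      unfolding q_def by (rule tower_level_seminorm[OF S tw C])
    have pn: "0 \<le> pair_seminorm (-1) (S M N) f" for N
      by (rule seminorm_nonneg[OF pair_seminorm[OF S] f]) simp
    have "midpoint_conv (q N0) f g"
    proof (rule midpoint_conv_SUP[where I = "{N. finite N \<and> card N \<le> m}"])
      show "lsc_seminorm K (2 * C) (q i)" for i by (rule q)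
      show "midpoint_conv (\<lambda>f. SUP N\<in>{N. finite N \<and> card N \<le> m}. q N f) f g"
        using conv by (simp add: midpoint_conv_def q_def)
      show "sqrt (e\<^sup>2 + ((1/2) ^ k * (C * unorm K f))\<^sup>2) < q N0 f"
        unfolding q_def
        by (intro real_sqrt_less_mono less_le_trans[OF kk]) (simp add: c_def)
      fix N assume N: "N \<in> {N. finite N \<and> card N \<le> m}" "N \<noteq> N0"
      have "(pair_seminorm (-1) (S M N) f)\<^sup>2 \<le> e\<^sup>2"
        using small[of N] N pn by (intro power_mono) auto
      moreover have "((1/2) ^ k * tower ls b (M \<union> N) f)\<^sup>2 \<le> ((1/2) ^ k * (C * unorm K f))\<^sup>2"
        using seminorm_nonneg[OF tw f] seminorm_bound[OF tw f]
        by (intro power_mono mult_left_mono) auto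
      ultimately show "q N f \<le> sqrt (e\<^sup>2 + ((1/2) ^ k * (C * unorm K f))\<^sup>2)"
        unfolding q_def by (intro real_sqrt_le_mono add_mono)
    qed (use N0 f g in auto)
    then show "midpoint_conv (tower ls b (M \<union> N0)) f g"
      unfolding q_def
      by (intro midpoint_conv_hypot[OF pair_seminorm[OF S] tw _ _ _ f]) (use C g in auto)
  qed
qed

section \<open>Ranks of points in scattered sets\<close>

text \<open>For a point of \<open>J\<close> this is the order \<open>\<xi>\<close> of the derivative in which the point is isolated; points
  outside \<open>J\<close> get the rank \<open>None\<close>, which lies below all others.\<close>

definition derived_rank :: "'a topology \<Rightarrow> 'o rel \<Rightarrow> 'a set \<Rightarrow> 'a \<Rightarrow> 'o option" where
  "derived_rank X \<Omega> J \<gamma> = (if \<gamma> \<in> J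
     then Some (wo_rel.minim \<Omega> {\<xi> \<in> Field \<Omega>. \<gamma> \<notin> non_isolated X (derived_below X J \<Omega> \<xi>)})
     else None)"

definition rank_le :: "'o rel \<Rightarrow> 'o option \<Rightarrow> 'o option \<Rightarrow> bool" where
  "rank_le \<Omega> r r' \<longleftrightarrow> (case r of None \<Rightarrow> True
     | Some \<xi> \<Rightarrow> (case r' of None \<Rightarrow> False | Some \<eta> \<Rightarrow> (\<xi>, \<eta>) \<in> \<Omega>))"

definition ranks :: "'o rel \<Rightarrow> 'o option set" where
  "ranks \<Omega> = insert None (Some ` Field \<Omega>)"

text \<open>Such a set \<open>V\<close> bounds ranks from above: for \<open>r = Some \<xi>\<close>, the points of rank at least \<open>\<xi>\<close> in \<open>V\<close> all lie in
  \<open>N\<close>, and for \<open>r = None\<close>, no point of \<open>V\<close> belongs to \<open>J\<close>. The point of the definition is that, with \<open>V\<close> from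
  a countable base and countably many ranks, it describes uncountably many sets \<open>J\<close> by countably many data.\<close>

definition confined ::
    "'a topology \<Rightarrow> 'o rel \<Rightarrow> 'a set \<Rightarrow> 'o option \<Rightarrow> 'a set \<Rightarrow> 'a set \<Rightarrow> bool" where
  "confined X \<Omega> J r V N \<longleftrightarrow> (case r of None \<Rightarrow> J \<inter> V = {}
     | Some \<xi> \<Rightarrow> derived_below X J \<Omega> \<xi> \<inter> V \<subseteq> N)"

lemma rank_least:
  assumes wo: "Well_order \<Omega>" and R: "R \<subseteq> ranks \<Omega>" "R \<noteq> {}"
  obtains r where "r \<in> R" "\<And>r'. r' \<in> R \<Longrightarrow> rank_le \<Omega> r r'"
proof (cases "None \<in> R")
  case True
  then show ?thesis using that[of None] by (auto simp: rank_le_def)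
next
  case False
  define A where "A = {\<xi>. Some \<xi> \<in> R}"
  have A: "A \<subseteq> Field \<Omega>" using R(1) by (auto simp: A_def ranks_def)
  obtain r where r: "r \<in> R" using R(2) by auto
  then obtain \<xi> where "\<xi> \<in> A" using False by (cases r) (auto simp: A_def)
  then have ne: "A \<noteq> {}" by auto
  have w: "wo_rel \<Omega>" using wo by (simp add: wo_rel_def)
  show ?thesis
  proof (rule that)
    show "Some (wo_rel.minim \<Omega> A) \<in> R" using wo_rel.minim_in[OF w A ne] by (simp add: A_def)
    fix r' assume "r' \<in> R"
    then show "rank_le \<Omega> (Some (wo_rel.minim \<Omega> A)) r'"
      using False wo_rel.minim_least[OF w A] by (cases r') (auto simp: A_def rank_le_def)
  qed
qed

lemma rank_le_antisym:
  "Well_order \<Omega> \<Longrightarrow> rank_le \<Omega> r r' \<Longrightarrow> rank_le \<Omega> r' r \<Longrightarrow> r = r'"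
  by (auto simp: rank_le_def wo_rel_def[symmetric] dest: wo_rel.ANTISYM antisymD split: option.splits)

text \<open>In a finite product of well-orders every nonempty set has a minimal element for the product order: minimise
  one coordinate after the other.\<close>

lemma minimal_rank_family:
  assumes wo: "Well_order \<Omega>" and "finite F"
    and "P \<noteq> {}" "\<And>j x. j \<in> F \<Longrightarrow> x \<in> P \<Longrightarrow> \<rho> j x \<in> ranks \<Omega>"
  shows "\<exists>x\<in>P. \<forall>y\<in>P. (\<forall>j\<in>F. rank_le \<Omega> (\<rho> j y) (\<rho> j x)) \<longrightarrow> (\<forall>j\<in>F. \<rho> j y = \<rho> j x)"
  using assms(2-)
proof (induction F arbitrary: P)
  case empty
  then show ?case by auto
next
  case (insert i F)
  have "\<rho> i ` P \<subseteq> ranks \<Omega>" "\<rho> i ` P \<noteq> {}" using insert.prems by auto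
  from rank_least[OF wo this]
  obtain r where r: "r \<in> \<rho> i ` P" "\<And>r'. r' \<in> \<rho> i ` P \<Longrightarrow> rank_le \<Omega> r r'" by blast
  define P' where "P' = {x \<in> P. \<rho> i x = r}"
  have "P' \<noteq> {}" using r(1) by (auto simp: P'_def)
  moreover have "\<rho> j x \<in> ranks \<Omega>" if "j \<in> F" "x \<in> P'" for j x
    using insert.prems(2) that by (auto simp: P'_def)
  ultimately obtain x where x: "x \<in> P'"
    "\<forall>y\<in>P'. (\<forall>j\<in>F. rank_le \<Omega> (\<rho> j y) (\<rho> j x)) \<longrightarrow> (\<forall>j\<in>F. \<rho> j y = \<rho> j x)"
    using insert.IH[of P'] by blast
  show ?case
  proof (intro bexI[of _ x] ballI impI)
    show "x \<in> P" using x(1) by (simp add: P'_def)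
    fix y j
    assume y: "y \<in> P" "\<forall>j\<in>insert i F. rank_le \<Omega> (\<rho> j y) (\<rho> j x)" and j: "j \<in> insert i F"
    have "rank_le \<Omega> (\<rho> i y) r" using y(2) x(1) by (simp add: P'_def)
    moreover have "rank_le \<Omega> r (\<rho> i y)" using r(2) y(1) by blast
    ultimately have "\<rho> i y = r" by (rule rank_le_antisym[OF wo])
    then have "y \<in> P'" using y(1) by (simp add: P'_def)
    moreover have "\<forall>j\<in>F. rank_le \<Omega> (\<rho> j y) (\<rho> j x)" using y(2) by simp
    ultimately have "\<forall>j\<in>F. \<rho> j y = \<rho> j x" using x(2) by meson
    moreover have "\<rho> i y = \<rho> i x" using \<open>\<rho> i y = r\<close> x(1) by (simp add: P'_def)
    ultimately show "\<rho> j y = \<rho> j x" using j by auto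
  qed
qed

lemma derived_rank_Some:
  assumes wo: "Well_order \<Omega>" and J: "derived_iterate X J \<Omega> = {}" and \<gamma>: "\<gamma> \<in> J"
  obtains \<xi> where "derived_rank X \<Omega> J \<gamma> = Some \<xi>" "\<xi> \<in> Field \<Omega>" "\<gamma> \<in> derived_below X J \<Omega> \<xi>"
    "\<gamma> \<notin> non_isolated X (derived_below X J \<Omega> \<xi>)"
    "\<And>\<eta>. \<eta> \<in> Field \<Omega> \<Longrightarrow> \<gamma> \<notin> non_isolated X (derived_below X J \<Omega> \<eta>) \<Longrightarrow> (\<xi>, \<eta>) \<in> \<Omega>"
proof -
  define A where "A = {\<xi> \<in> Field \<Omega>. \<gamma> \<notin> non_isolated X (derived_below X J \<Omega> \<xi>)}"
  have w: "wo_rel \<Omega>" using wo by (simp add: wo_rel_def)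
  have A: "A \<subseteq> Field \<Omega>" "A \<noteq> {}"
    using J \<gamma> by (auto simp: A_def derived_iterate_def derived_step_def split: if_splits)
  define \<xi> where "\<xi> = wo_rel.minim \<Omega> A"
  have \<xi>: "\<xi> \<in> A" unfolding \<xi>_def by (rule wo_rel.minim_in[OF w A])
  have least: "(\<xi>, \<eta>) \<in> \<Omega>" if "\<eta> \<in> A" for \<eta>
    unfolding \<xi>_def by (rule wo_rel.minim_least[OF w A(1) that])
  have "\<gamma> \<in> non_isolated X (derived_below X J \<Omega> \<eta>)" if "\<eta> \<in> underS \<Omega> \<xi>" for \<eta>
  proof (rule ccontr)
    assume "\<not> ?thesis"
    moreover have \<eta>: "\<eta> \<noteq> \<xi>" "(\<eta>, \<xi>) \<in> \<Omega>" using that by (auto simp: underS_def)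
    ultimately have "(\<xi>, \<eta>) \<in> \<Omega>" by (intro least) (auto simp: A_def Field_def)
    with \<eta> show False using wo_rel.ANTISYM[OF w] by (auto dest: antisymD)
  qed
  then have "\<gamma> \<in> derived_below X J \<Omega> \<xi>"
    using \<gamma> by (subst derived_below_unfold[OF wo]) (auto simp: derived_step_def)
  moreover have "derived_rank X \<Omega> J \<gamma> = Some \<xi>"
    using \<gamma> by (simp add: derived_rank_def \<xi>_def A_def)
  ultimately show ?thesis using that \<xi> least by (auto simp: A_def)
qed

lemma derived_rank_in_ranks:
  assumes "Well_order \<Omega>" "derived_iterate X J \<Omega> = {}"
  shows "derived_rank X \<Omega> J \<gamma> \<in> ranks \<Omega>"
proof (cases "\<gamma> \<in> J")
  case True
  from derived_rank_Some[OF assms this] show ?thesis by (metis imageI insertI2 ranks_def)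
qed (simp add: derived_rank_def ranks_def)

text \<open>In a \<open>T\<^sub>1\<close> space, a finite trace of a derivative on an open set consists of isolated points of that
  derivative.\<close>

lemma confined_rank_le:
  assumes wo: "Well_order \<Omega>" and J: "derived_iterate X J \<Omega> = {}" and t1: "t1_space X"
    and V: "openin X V" "\<gamma> \<in> V" and N: "finite N" and r: "r \<in> ranks \<Omega>"
    and conf: "confined X \<Omega> J r V N"
  shows "rank_le \<Omega> (derived_rank X \<Omega> J \<gamma>) r"
proof (cases "\<gamma> \<in> J")
  case False
  then show ?thesis by (simp add: derived_rank_def rank_le_def)
next
  case True
  then obtain \<eta> where \<eta>: "r = Some \<eta>" "\<eta> \<in> Field \<Omega>"
    using conf V r by (auto simp: confined_def ranks_def split: option.splits)
  obtain \<xi> where \<xi>: "derived_rank X \<Omega> J \<gamma> = Some \<xi>"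
    "\<And>\<eta>. \<eta> \<in> Field \<Omega> \<Longrightarrow> \<gamma> \<notin> non_isolated X (derived_below X J \<Omega> \<eta>) \<Longrightarrow> (\<xi>, \<eta>) \<in> \<Omega>"
    by (rule derived_rank_Some[OF wo J True]) (rule that)
  let ?E = "derived_below X J \<Omega> \<eta>"
  have "\<gamma> \<notin> non_isolated X ?E"
  proof
    assume "\<gamma> \<in> non_isolated X ?E"
    then have \<gamma>: "\<gamma> \<in> ?E" "\<not> openin (subtopology X ?E) {\<gamma>}" by (auto simp: non_isolated_def)
    have "closedin X (topspace X \<inter> (N - {\<gamma>}))"
      using t1 N by (auto simp: t1_space_closedin_finite)
    then have "openin X (V - (topspace X \<inter> (N - {\<gamma>})))" using V(1) by (rule openin_diff[rotated])
    moreover have "(V - (topspace X \<inter> (N - {\<gamma>}))) \<inter> ?E = {\<gamma>}"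
      using conf \<eta>(1) \<gamma>(1) V openin_subset[OF V(1)] by (auto simp: confined_def)
    ultimately show False using \<gamma>(2) by (auto simp: openin_subtopology)
  qed
  then have "(\<xi>, \<eta>) \<in> \<Omega>" using \<xi>(2) \<eta>(2) by blast
  then show ?thesis using \<xi>(1) \<eta>(1) by (simp add: rank_le_def)
qed

lemma confined_mem:
  assumes wo: "Well_order \<Omega>" and J: "derived_iterate X J \<Omega> = {}" and \<gamma>: "\<gamma> \<in> J" "\<gamma> \<in> V"
    and conf: "confined X \<Omega> J (derived_rank X \<Omega> J \<gamma>) V N"
  shows "\<gamma> \<in> N"
proof -
  obtain \<xi> where "derived_rank X \<Omega> J \<gamma> = Some \<xi>" "\<gamma> \<in> derived_below X J \<Omega> \<xi>"
    by (rule derived_rank_Some[OF wo J \<gamma>(1)]) (rule that)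
  then show ?thesis using conf \<gamma>(2) by (auto simp: confined_def)
qed

lemma confined_exists:
  assumes wo: "Well_order \<Omega>" and J: "derived_iterate X J \<Omega> = {}" "closedin X J"
    and \<B>: "\<And>U x. openin X U \<Longrightarrow> x \<in> U \<Longrightarrow> \<exists>V\<in>\<B>. x \<in> V \<and> V \<subseteq> U"
    and \<gamma>: "\<gamma> \<in> topspace X" "\<gamma> \<in> J \<Longrightarrow> \<gamma> \<in> N"
  obtains V where "V \<in> \<B>" "\<gamma> \<in> V" "confined X \<Omega> J (derived_rank X \<Omega> J \<gamma>) V N"
proof (cases "\<gamma> \<in> J")
  case False
  have "openin X (topspace X - J)" using J(2) by blast
  then obtain V where "V \<in> \<B>" "\<gamma> \<in> V" "V \<subseteq> topspace X - J" using \<B> False \<gamma>(1) by blast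
  moreover have "derived_rank X \<Omega> J \<gamma> = None" using False by (simp add: derived_rank_def)
  ultimately show ?thesis using that[of V] by (auto simp: confined_def)
next
  case True
  obtain \<xi> where \<xi>: "derived_rank X \<Omega> J \<gamma> = Some \<xi>" "\<gamma> \<in> derived_below X J \<Omega> \<xi>"
    "\<gamma> \<notin> non_isolated X (derived_below X J \<Omega> \<xi>)"
    by (rule derived_rank_Some[OF wo J(1) True]) (rule that)
  then obtain U where U: "openin X U" "{\<gamma>} = U \<inter> derived_below X J \<Omega> \<xi>"
    by (auto simp: non_isolated_def openin_subtopology)
  then obtain V where "V \<in> \<B>" "\<gamma> \<in> V" "V \<subseteq> U" using \<B> by blast
  moreover from this have "derived_below X J \<Omega> \<xi> \<inter> V \<subseteq> {\<gamma>}" using U(2) by blast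
  ultimately show ?thesis using that[of V] \<xi>(1) \<gamma>(2)[OF True] by (auto simp: confined_def)
qed

section \<open>Oscillation\<close>

lemma closedin_osc_set: "closedin X (osc_set X s \<delta>)"
proof -
  have "openin X (topspace X - osc_set X s \<delta>)"
  proof (subst openin_subopen, intro ballI)
    fix \<gamma> assume "\<gamma> \<in> topspace X - osc_set X s \<delta>"
    then obtain U where U: "openin X U" "\<gamma> \<in> U" "\<not> osc s U > ereal \<delta>"
      by (auto simp: osc_set_def)
    then have "U \<subseteq> topspace X - osc_set X s \<delta>"
      using openin_subset[OF U(1)] by (auto simp: osc_set_def)
    then show "\<exists>T. openin X T \<and> \<gamma> \<in> T \<and> T \<subseteq> topspace X - osc_set X s \<delta>" using U by blast
  qed
  moreover have "osc_set X s \<delta> \<subseteq> topspace X" by (auto simp: osc_set_def)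
  ultimately show ?thesis by (simp add: closedin_def)
qed

lemma dist_le_osc:
  assumes "osc s U \<le> ereal \<delta>" "\<alpha> \<in> U" "\<beta> \<in> U"
  shows "\<bar>s \<alpha> - s \<beta>\<bar> \<le> \<delta>"
proof -
  have "ereal \<bar>s \<alpha> - s \<beta>\<bar> \<le> osc s U"
    unfolding osc_def using assms(2,3) by (intro SUP_upper2[of "(\<alpha>, \<beta>)"]) auto
  then show ?thesis using assms(1) by (metis ereal_less_eq(3) order_trans)
qed

text \<open>If both functions oscillate by at most \<open>\<delta>\<close> near \<open>\<gamma>\<close>, their values at \<open>\<gamma>\<close> can be compared through a nearby
  point of the dense set, where they agree.\<close>

lemma difference_in_osc_sets:
  assumes D: "X closure_of D = topspace X" "\<And>x. x \<in> D \<Longrightarrow> s x = t x"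
    and \<gamma>: "\<gamma> \<in> topspace X" "2 * \<delta> < \<bar>s \<gamma> - t \<gamma>\<bar>"
  shows "\<gamma> \<in> osc_set X s \<delta> \<union> osc_set X t \<delta>"
proof (rule ccontr)
  assume "\<not> ?thesis"
  then obtain U U' where U: "openin X U" "\<gamma> \<in> U" "osc s U \<le> ereal \<delta>"
    and U': "openin X U'" "\<gamma> \<in> U'" "osc t U' \<le> ereal \<delta>"
    using \<gamma>(1) by (auto simp: osc_set_def not_less)
  have "\<gamma> \<in> X closure_of D" using D(1) \<gamma>(1) by simp
  moreover have "openin X (U \<inter> U')" "\<gamma> \<in> U \<inter> U'" using U U' by auto
  ultimately obtain d where d: "d \<in> D" "d \<in> U \<inter> U'" by (auto simp: in_closure_of)
  have "\<bar>s \<gamma> - s d\<bar> \<le> \<delta>" "\<bar>t \<gamma> - t d\<bar> \<le> \<delta>"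
    using dist_le_osc[OF U(3), of \<gamma> d] dist_le_osc[OF U'(3), of \<gamma> d] U U' d by auto
  then show False using \<gamma>(2) D(2)[OF d(1)] by linarith
qed

section \<open>Compactness and separability\<close>

text \<open>The pairs that \<open>f\<close> separates by at least \<open>e\<close> form a compact set, and each of them is separated by
  some coordinate in \<open>B\<close>; so finitely many coordinates suffice, with a uniform distance.\<close>

lemma finite_control:
  fixes K :: "('a \<Rightarrow> real) set"
  assumes K: "compactin (pointwise_topology G) K"
    and f: "continuous_map (subtopology (pointwise_topology G) K) euclideanreal f"
    and B: "B \<subseteq> G"
    and eq: "\<And>s t. s \<in> K \<Longrightarrow> t \<in> K \<Longrightarrow> (\<And>\<gamma>. \<gamma> \<in> B \<Longrightarrow> s \<gamma> = t \<gamma>) \<Longrightarrow> \<bar>f s - f t\<bar> < e"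
  obtains F n where "finite F" "F \<subseteq> B"
    "\<And>s t. s \<in> K \<Longrightarrow> t \<in> K \<Longrightarrow> (\<And>\<gamma>. \<gamma> \<in> F \<Longrightarrow> \<bar>s \<gamma> - t \<gamma>\<bar> \<le> 1 / real (Suc n)) \<Longrightarrow> \<bar>f s - f t\<bar> < e"
proof -
  define T where "T = subtopology (pointwise_topology G) K"
  have Ksub: "K \<subseteq> topspace (pointwise_topology G)" using K by (rule compactin_subset_topspace)
  then have T: "topspace T = K" by (auto simp: T_def)
  have "compact_space T" using K by (simp add: T_def compact_space_subtopology)
  then have TT: "compact_space (prod_topology T T)" by (simp add: compact_space_prod_topology)
  have cont: "continuous_map (prod_topology T T) euclideanreal (\<lambda>z. \<bar>h (fst z) - h (snd z)\<bar>)"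
    if "continuous_map T euclideanreal h" for h
    by (intro continuous_map_real_abs continuous_map_diff)
      (use continuous_map_compose[OF continuous_map_fst that] continuous_map_compose[OF continuous_map_snd that]
        in \<open>auto simp: o_def\<close>)
  define C where "C = {z \<in> topspace (prod_topology T T). \<bar>f (fst z) - f (snd z)\<bar> \<in> {e..}}"
  define W where "W = (\<lambda>(\<gamma>, n). {z \<in> topspace (prod_topology T T).
      \<bar>fst z \<gamma> - snd z \<gamma>\<bar> \<in> {1 / real (Suc n)<..}})"
  have "closedin (prod_topology T T) C" unfolding C_def
    by (rule closedin_continuous_map_preimage[OF cont]) (use f in \<open>auto simp: T_def\<close>)
  then have C: "compactin (prod_topology T T) C" using TT closedin_compact_space by blast
  have "continuous_map T euclideanreal (\<lambda>s. s \<gamma>)" if "\<gamma> \<in> G" for \<gamma>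
    unfolding T_def by (rule continuous_map_from_subtopology[OF continuous_map_product_projection[OF that]])
  then have opens: "openin (prod_topology T T) (W (\<gamma>, n))" if "\<gamma> \<in> B" for \<gamma> n
    unfolding W_def prod.case
    by (intro openin_continuous_map_preimage[OF cont]) (use that B in auto)
  have cover: "C \<subseteq> \<Union> (W ` (B \<times> UNIV))"
  proof
    fix z assume z: "z \<in> C"
    then obtain s t where st: "z = (s, t)" "s \<in> K" "t \<in> K" "e \<le> \<bar>f s - f t\<bar>"
      by (cases z) (auto simp: C_def T)
    then obtain \<gamma> where \<gamma>: "\<gamma> \<in> B" "s \<gamma> \<noteq> t \<gamma>" using eq[of s t] by fastforce
    then obtain n where "1 / real (Suc n) < \<bar>s \<gamma> - t \<gamma>\<bar>"
      using reals_Archimedean[of "\<bar>s \<gamma> - t \<gamma>\<bar>"] by (auto simp: inverse_eq_divide)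
    then have "z \<in> W (\<gamma>, n)" using st by (simp add: W_def T)
    then show "z \<in> \<Union> (W ` (B \<times> UNIV))" using \<gamma>(1) by blast
  qed
  have "\<exists>\<F>. finite \<F> \<and> \<F> \<subseteq> W ` (B \<times> UNIV) \<and> C \<subseteq> \<Union>\<F>"
    using C cover opens unfolding compactin_def by auto
  then obtain \<F> where \<F>: "finite \<F>" "\<F> \<subseteq> W ` (B \<times> UNIV)" "C \<subseteq> \<Union>\<F>" by blast
  then obtain I where I: "I \<subseteq> B \<times> UNIV" "finite I" "\<F> = W ` I"
    using finite_subset_image[OF \<F>(1,2)] by blast
  define n where "n = Max (insert 0 (snd ` I))"
  show ?thesis
  proof (rule that[of "fst ` I" n])
    show "finite (fst ` I)" "fst ` I \<subseteq> B" using I by auto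
    fix s t assume st: "s \<in> K" "t \<in> K" and close: "\<And>\<gamma>. \<gamma> \<in> fst ` I \<Longrightarrow> \<bar>s \<gamma> - t \<gamma>\<bar> \<le> 1 / real (Suc n)"
    show "\<bar>f s - f t\<bar> < e"
    proof (rule ccontr)
      assume "\<not> \<bar>f s - f t\<bar> < e"
      then have "(s, t) \<in> C" using st by (simp add: C_def T)
      then obtain \<gamma> m where m: "(\<gamma>, m) \<in> I" "(s, t) \<in> W (\<gamma>, m)" using \<F>(3) I(3) by auto
      have "m \<le> n" unfolding n_def using I(2) m(1) by (intro Max_ge) (auto simp: rev_image_eqI)
      then have "1 / real (Suc n) \<le> 1 / real (Suc m)" by (simp add: frac_le)
      moreover have "\<bar>s \<gamma> - t \<gamma>\<bar> \<le> 1 / real (Suc n)" using close m(1) by (simp add: rev_image_eqI)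
      ultimately show False using m(2) by (simp add: W_def)
    qed
  qed
qed

lemma separable_metrizable_countable_base:
  assumes "metrizable_space X" "separable_space X"
  obtains \<B> where "countable \<B>" "\<And>V. V \<in> \<B> \<Longrightarrow> openin X V"
    "\<And>U x. openin X U \<Longrightarrow> x \<in> U \<Longrightarrow> \<exists>V\<in>\<B>. x \<in> V \<and> V \<subseteq> U"
proof -
  obtain S d where Sd: "Metric_space S d" "X = Metric_space.mtopology S d"
    using assms(1) by (auto simp: metrizable_space_def)
  interpret Metric_space S d by (rule Sd(1))
  obtain C where C: "countable C" "C \<subseteq> topspace X" "X closure_of C = topspace X"
    using assms(2) by (auto simp: separable_space_def)
  define \<B> where "\<B> = (\<lambda>(c, n). mball c (1 / real (Suc n))) ` (C \<times> UNIV)"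
  show ?thesis
  proof (rule that[of \<B>])
    show "countable \<B>" unfolding \<B>_def using C(1) by (intro countable_image countable_SIGMA) auto
    show "openin X V" if "V \<in> \<B>" for V using that Sd(2) by (auto simp: \<B>_def)
    fix U x assume U: "openin X U" "x \<in> U"
    then obtain r where r: "r > 0" "mball x r \<subseteq> U" and x: "x \<in> S"
      unfolding Sd(2) openin_mtopology by blast
    obtain n where n: "1 / real (Suc n) < r / 2"
      using reals_Archimedean[of "r / 2"] r(1) by (auto simp: inverse_eq_divide)
    have "x \<in> X closure_of C" using C(3) Sd(2) x by simp
    moreover have "openin X (mball x (1 / real (Suc n)))" "x \<in> mball x (1 / real (Suc n))"
      using Sd(2) x by auto
    ultimately obtain c where c: "c \<in> C" "c \<in> mball x (1 / real (Suc n))"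
      unfolding in_closure_of by blast
    show "\<exists>V\<in>\<B>. x \<in> V \<and> V \<subseteq> U"
    proof (intro bexI conjI)
      show "mball c (1 / real (Suc n)) \<in> \<B>" using c(1) by (auto simp: \<B>_def)
      show "x \<in> mball c (1 / real (Suc n))" using c(2) by (simp add: commute)
      show "mball c (1 / real (Suc n)) \<subseteq> U"
      proof
        fix y assume y: "y \<in> mball c (1 / real (Suc n))"
        have "d x y \<le> d x c + d c y" using c y x by (intro triangle) auto
        then have "y \<in> mball x r" using c y x n by simp
        then show "y \<in> U" using r(2) by blast
      qed
    qed
  qed
qed

section \<open>Selecting the control points\<close>

text \<open>A countable base and a countable dense set are fixed because they supply the parameters of the norm.\<close>

locale bounded_rank_compactum =
  fixes X :: "'a topology" and \<Omega> :: "'o rel" and K :: "('a \<Rightarrow> real) set"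
    and \<B> :: "'a set set" and D :: "'a set"
  assumes wo: "Well_order \<Omega>" and countable_Field: "countable (Field \<Omega>)"
    and compact_K: "compactin (pointwise_topology (topspace X)) K"
    and t1: "t1_space X"
    and countable_base: "countable \<B>" and base_open: "\<And>V. V \<in> \<B> \<Longrightarrow> openin X V"
    and base: "\<And>U x. openin X U \<Longrightarrow> x \<in> U \<Longrightarrow> \<exists>V\<in>\<B>. x \<in> V \<and> V \<subseteq> U"
    and countable_D: "countable D" and D: "D \<subseteq> topspace X" "X closure_of D = topspace X"
    and derived_empty: "\<And>s \<delta>. s \<in> K \<Longrightarrow> \<delta> > 0 \<Longrightarrow> derived_iterate X (osc_set X s \<delta>) \<Omega> = {}"
begin

abbreviation jumps :: "nat \<Rightarrow> ('a \<Rightarrow> real) \<Rightarrow> 'a set" where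
  "jumps m s \<equiv> osc_set X s (1 / real (Suc m))"

text \<open>Two elements of \<open>K\<close> that agree on \<open>D\<close> can differ substantially only at their jumps. The selector collects
  such pairs whose jumps have, in prescribed places, ranks below prescribed ones, except for the jumps in
  \<open>N\<close>. The places and ranks are encoded by \<open>P\<close> and \<open>Q\<close>, which range over a countable
  set, while \<open>M\<close> and \<open>N\<close> are arbitrary.\<close>

definition selector :: "nat \<Rightarrow> ('a set \<times> 'o option) set \<Rightarrow> ('a set \<times> 'o option) set
    \<Rightarrow> 'a set \<Rightarrow> 'a set \<Rightarrow> (('a \<Rightarrow> real) \<times> ('a \<Rightarrow> real)) set" where
  "selector m P Q M N = {(s, t) \<in> K \<times> K. (\<forall>x\<in>D \<union> M. s x = t x) \<and>
     (\<forall>(V, r)\<in>P. confined X \<Omega> (jumps m s) r V N) \<and>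
     (\<forall>(V, r)\<in>Q. confined X \<Omega> (jumps m t) r V N)}"

definition selectors :: "('a set \<Rightarrow> 'a set \<Rightarrow> (('a \<Rightarrow> real) \<times> ('a \<Rightarrow> real)) set) set" where
  "selectors = (\<lambda>(m, P, Q). selector m P Q) `
     (UNIV \<times> {P. finite P \<and> P \<subseteq> \<B> \<times> ranks \<Omega>} \<times> {Q. finite Q \<and> Q \<subseteq> \<B> \<times> ranks \<Omega>})"

lemma countable_selectors: "countable selectors"
proof -
  have "countable (ranks \<Omega>)" using countable_Field by (auto simp: ranks_def)
  then show ?thesis unfolding selectors_def
    by (intro countable_image countable_SIGMA countable_Collect_finite_subset countableI_type
        countable_base)
qed

lemma selectors_subset: "S \<in> selectors \<Longrightarrow> S M N \<subseteq> K \<times> K"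
  by (auto simp: selectors_def selector_def)

lemma jumps_empty: "s \<in> K \<Longrightarrow> derived_iterate X (jumps m s) \<Omega> = {}"
  by (rule derived_empty) simp_all

text \<open>The heart of the proof. Suppose that the coordinates in \<open>Mh\<close> control \<open>f\<close> up to \<open>e\<close>, but those in
  \<open>D \<union> M\<close> do not. Among the pairs that agree on \<open>D \<union> M\<close> and that \<open>f\<close> separates by more than \<open>e\<close>, take
  one for which the ranks, in both jump sets, of the points of \<open>Mh\<close> are minimal. Let \<open>N0\<close>
  be the set of points of \<open>Mh\<close> at which the pair jumps, and let the selector record basic neighbourhoods and
  ranks of the points of \<open>Mh\<close>. If a pair selected by some \<open>N\<close> of at most the same size is
  separated by more than \<open>e\<close>, then its ranks are at most, hence by minimality equal to, the recorded ones;
  this puts every point of \<open>N0\<close> into \<open>N\<close>, and so \<open>N = N0\<close>.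

  Some point of \<open>N0\<close> is not in \<open>M\<close>, since the chosen pair must differ substantially at some point of
  \<open>Mh\<close>; this gives progress when the step is iterated.\<close>

lemma selection_step:
  assumes f: "f \<in> bdd_on K" and e: "0 \<le> e" and Mh: "finite Mh" "Mh \<subseteq> topspace X"
    and ctrl: "\<And>s t. s \<in> K \<Longrightarrow> t \<in> K \<Longrightarrow> (\<And>\<gamma>. \<gamma> \<in> Mh \<Longrightarrow> \<bar>s \<gamma> - t \<gamma>\<bar> \<le> 2 / real (Suc m))
      \<Longrightarrow> \<bar>f s - f t\<bar> \<le> e"
    and ex: "s0 \<in> K" "t0 \<in> K" "\<And>x. x \<in> D \<union> M \<Longrightarrow> s0 x = t0 x" "e < \<bar>f s0 - f t0\<bar>"
  obtains S N0 where "S \<in> selectors" "N0 \<subseteq> Mh" "\<not> N0 \<subseteq> M"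
    "e < pair_seminorm (-1) (S M N0) f"
    "\<And>N. finite N \<Longrightarrow> card N \<le> card N0 \<Longrightarrow> N \<noteq> N0 \<Longrightarrow> pair_seminorm (-1) (S M N) f \<le> e"
proof -
  define P where "P = {(s, t) \<in> K \<times> K. (\<forall>x\<in>D \<union> M. s x = t x) \<and> e < \<bar>f s - f t\<bar>}"
  define \<rho> where "\<rho> = (\<lambda>(\<gamma>, b) (s, t). derived_rank X \<Omega> (jumps m (if b then s else t)) \<gamma>)"
  have ranks: "derived_rank X \<Omega> (jumps m s) \<gamma> \<in> ranks \<Omega>" if "s \<in> K" for s \<gamma>
    by (rule derived_rank_in_ranks[OF wo jumps_empty[OF that]])
  have "P \<noteq> {}" using ex by (auto simp: P_def)
  moreover have "\<rho> j x \<in> ranks \<Omega>" if "j \<in> Mh \<times> UNIV" "x \<in> P" for j x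
    using that ranks by (auto simp: \<rho>_def P_def split: prod.splits)
  ultimately obtain x where x: "x \<in> P" "\<And>y. y \<in> P \<Longrightarrow>
      (\<forall>j\<in>Mh \<times> UNIV. rank_le \<Omega> (\<rho> j y) (\<rho> j x)) \<Longrightarrow> (\<forall>j\<in>Mh \<times> UNIV. \<rho> j y = \<rho> j x)"
    using minimal_rank_family[OF wo, of "Mh \<times> UNIV" P \<rho>] Mh(1) by (simp add: finite_cartesian_product) blast
  obtain s t where st: "x = (s, t)" by (cases x)
  have K: "s \<in> K" "t \<in> K" and eq: "\<And>x. x \<in> D \<union> M \<Longrightarrow> s x = t x" and gap: "e < \<bar>f s - f t\<bar>"
    using x(1) st by (auto simp: P_def)
  define N0 where "N0 = Mh \<inter> (jumps m s \<union> jumps m t)"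
  have finN0: "finite N0" using Mh(1) by (simp add: N0_def)
  have "\<exists>V. V \<in> \<B> \<and> \<gamma> \<in> V \<and> confined X \<Omega> (jumps m u) (derived_rank X \<Omega> (jumps m u) \<gamma>) V N0"
    if u: "u = s \<or> u = t" and \<gamma>: "\<gamma> \<in> Mh" for u \<gamma>
  proof -
    have "u \<in> K" using u K by auto
    have "\<gamma> \<in> jumps m u \<Longrightarrow> \<gamma> \<in> N0" using u \<gamma> by (auto simp: N0_def)
    from confined_exists[OF wo jumps_empty[OF \<open>u \<in> K\<close>] closedin_osc_set base subsetD[OF Mh(2) \<gamma>] this]
    show ?thesis by metis
  qed
  then obtain V W
    where V: "\<And>\<gamma>. \<gamma> \<in> Mh \<Longrightarrow> V \<gamma> \<in> \<B> \<and> \<gamma> \<in> V \<gamma> \<and>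
        confined X \<Omega> (jumps m s) (derived_rank X \<Omega> (jumps m s) \<gamma>) (V \<gamma>) N0"
      and W: "\<And>\<gamma>. \<gamma> \<in> Mh \<Longrightarrow> W \<gamma> \<in> \<B> \<and> \<gamma> \<in> W \<gamma> \<and>
        confined X \<Omega> (jumps m t) (derived_rank X \<Omega> (jumps m t) \<gamma>) (W \<gamma>) N0"
    by metis
  define R where "R = (\<lambda>\<gamma>. (V \<gamma>, derived_rank X \<Omega> (jumps m s) \<gamma>)) ` Mh"
  define Q where "Q = (\<lambda>\<gamma>. (W \<gamma>, derived_rank X \<Omega> (jumps m t) \<gamma>)) ` Mh"
  define S where "S = selector m R Q"
  show ?thesis
  proof (rule that[of S N0])
    have "finite R" "R \<subseteq> \<B> \<times> ranks \<Omega>" "finite Q" "Q \<subseteq> \<B> \<times> ranks \<Omega>"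
      using V W Mh(1) ranks K by (auto simp: R_def Q_def)
    then show S: "S \<in> selectors"
      unfolding selectors_def S_def by (intro image_eqI[of _ _ "(m, R, Q)"]) auto
    show "N0 \<subseteq> Mh" by (auto simp: N0_def)
    show "\<not> N0 \<subseteq> M"
    proof -
      obtain \<gamma> where \<gamma>: "\<gamma> \<in> Mh" "2 / real (Suc m) < \<bar>s \<gamma> - t \<gamma>\<bar>"
        using ctrl[OF K] gap by (meson not_le)
      then have "\<gamma> \<in> N0"
        using difference_in_osc_sets[OF D(2), of s t \<gamma> "1 / real (Suc m)"] eq Mh(2)
        by (auto simp: N0_def)
      moreover have "0 < \<bar>s \<gamma> - t \<gamma>\<bar>" by (rule le_less_trans[OF _ \<gamma>(2)]) simp
      then have "\<gamma> \<notin> M" using eq[of \<gamma>] by auto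
      ultimately show ?thesis by blast
    qed
    have "(s, t) \<in> S M N0"
      unfolding S_def selector_def using K eq V W by (auto simp: R_def Q_def)
    then have "\<bar>f s + -1 * f t\<bar> \<le> pair_seminorm (-1) (S M N0) f"
      by (intro pair_seminorm_ge[OF selectors_subset[OF S] _ f]) auto
    then show "e < pair_seminorm (-1) (S M N0) f" using gap by simp
    fix N assume N: "finite N" "card N \<le> card N0" "N \<noteq> N0"
    show "pair_seminorm (-1) (S M N) f \<le> e"
    proof (rule pair_seminorm_le[OF e], rule ccontr)
      fix s' t' assume S': "(s', t') \<in> S M N" and "\<not> \<bar>f s' + -1 * f t'\<bar> \<le> e"
      then have y: "(s', t') \<in> P" by (auto simp: P_def S_def selector_def)
      then have K': "s' \<in> K" "t' \<in> K" by (auto simp: P_def)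
      have confs: "confined X \<Omega> (jumps m s') (derived_rank X \<Omega> (jumps m s) \<gamma>) (V \<gamma>) N"
        "confined X \<Omega> (jumps m t') (derived_rank X \<Omega> (jumps m t) \<gamma>) (W \<gamma>) N" if "\<gamma> \<in> Mh" for \<gamma>
        using S' that by (auto simp: S_def selector_def R_def Q_def)
      have le: "rank_le \<Omega> (derived_rank X \<Omega> (jumps m s') \<gamma>) (derived_rank X \<Omega> (jumps m s) \<gamma>)"
        "rank_le \<Omega> (derived_rank X \<Omega> (jumps m t') \<gamma>) (derived_rank X \<Omega> (jumps m t) \<gamma>)"
        if "\<gamma> \<in> Mh" for \<gamma>
        using confined_rank_le[OF wo jumps_empty[OF K'(1)] t1 _ _ N(1) ranks[OF K(1)] confs(1)[OF that]]
          confined_rank_le[OF wo jumps_empty[OF K'(2)] t1 _ _ N(1) ranks[OF K(2)] confs(2)[OF that]]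
          V[OF that] W[OF that] base_open by blast+
      have "\<forall>j\<in>Mh \<times> UNIV. \<rho> j (s', t') = \<rho> j x"
        by (rule x(2)[OF y]) (use le in \<open>auto simp: \<rho>_def st\<close>)
      then have "\<rho> (\<gamma>, b) (s', t') = \<rho> (\<gamma>, b) (s, t)" if "\<gamma> \<in> Mh" for \<gamma> b using that st by blast
      from this[of _ True] this[of _ False]
      have eqr: "derived_rank X \<Omega> (jumps m s') \<gamma> = derived_rank X \<Omega> (jumps m s) \<gamma>"
        "derived_rank X \<Omega> (jumps m t') \<gamma> = derived_rank X \<Omega> (jumps m t) \<gamma>" if "\<gamma> \<in> Mh" for \<gamma>
        using that by (simp_all add: \<rho>_def)
      have mem_iff: "\<gamma> \<in> J \<longleftrightarrow> derived_rank X \<Omega> J \<gamma> \<noteq> None" for \<gamma> J by (simp add: derived_rank_def)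
      have "N0 \<subseteq> N"
      proof
        fix \<gamma> assume "\<gamma> \<in> N0"
        then have \<gamma>: "\<gamma> \<in> Mh" and "\<gamma> \<in> jumps m s \<or> \<gamma> \<in> jumps m t" by (auto simp: N0_def)
        then have "\<gamma> \<in> jumps m s' \<or> \<gamma> \<in> jumps m t'" using eqr[OF \<gamma>] mem_iff by metis
        then show "\<gamma> \<in> N"
          using confined_mem[OF wo jumps_empty[OF K'(1)], of \<gamma> m "V \<gamma>" N]
            confined_mem[OF wo jumps_empty[OF K'(2)], of \<gamma> m "W \<gamma>" N]
            confs[OF \<gamma>] eqr[OF \<gamma>] V[OF \<gamma>] W[OF \<gamma>] by auto
      qed
      then show False using card_seteq[OF N(1) _ N(2)] N(3) by blast
    qed
  qed
qed

text \<open>Every selection step adds a point of the finite set \<open>Mh\<close> to \<open>M\<close>, so finitely many steps lead to a set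
  \<open>M'\<close> which together with \<open>D\<close> controls \<open>f\<close>, and each step is a level of the tower.\<close>

lemma descend_to_control:
  assumes f: "f \<in> bdd_on K" and e: "0 \<le> e" and Mh: "finite Mh" "Mh \<subseteq> topspace X"
    and ctrl: "\<And>s t. s \<in> K \<Longrightarrow> t \<in> K \<Longrightarrow> (\<And>\<gamma>. \<gamma> \<in> Mh \<Longrightarrow> \<bar>s \<gamma> - t \<gamma>\<bar> \<le> 2 / real (Suc m))
      \<Longrightarrow> \<bar>f s - f t\<bar> \<le> e"
    and M: "finite M" "M \<subseteq> topspace X"
  shows "\<exists>ls M'. ls \<in> lists (selectors \<times> UNIV) \<and> finite M' \<and> M' \<subseteq> topspace X \<and>
    (\<forall>s\<in>K. \<forall>t\<in>K. (\<forall>x\<in>D \<union> M'. s x = t x) \<longrightarrow> \<bar>f s - f t\<bar> \<le> e) \<and>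
    (\<forall>b g. (\<forall>M. lsc_seminorm K 2 (b M)) \<longrightarrow> (\<forall>n. g n \<in> bdd_on K) \<longrightarrow>
      midpoint_conv (tower ls b M) f g \<longrightarrow> midpoint_conv (b M') f g)"
  using M
proof (induction "card (Mh - M)" arbitrary: M rule: less_induct)
  case less
  show ?case
  proof (cases "\<forall>s\<in>K. \<forall>t\<in>K. (\<forall>x\<in>D \<union> M. s x = t x) \<longrightarrow> \<bar>f s - f t\<bar> \<le> e")
    case True
    have "tower [] b M = b M" for b :: "_ \<Rightarrow> (('a \<Rightarrow> real) \<Rightarrow> real) \<Rightarrow> real" by (rule ext) simp
    then show ?thesis using True less.prems by (intro exI[of _ "[]"] exI[of _ M]) auto
  next
    case False
    then obtain s t where "s \<in> K" "t \<in> K" "\<And>x. x \<in> D \<union> M \<Longrightarrow> s x = t x" "e < \<bar>f s - f t\<bar>"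
      by (auto simp: not_le)
    from selection_step[OF f e Mh ctrl this]
    obtain S N0 where S: "S \<in> selectors" and N0: "N0 \<subseteq> Mh" "\<not> N0 \<subseteq> M"
      and large: "e < pair_seminorm (-1) (S M N0) f"
      and small: "\<And>N. finite N \<Longrightarrow> card N \<le> card N0 \<Longrightarrow> N \<noteq> N0 \<Longrightarrow> pair_seminorm (-1) (S M N) f \<le> e"
      by blast
    have finN0: "finite N0" using N0(1) Mh(1) by (rule finite_subset)
    have "Mh - (M \<union> N0) \<subset> Mh - M" using N0 by blast
    then have decr: "card (Mh - (M \<union> N0)) < card (Mh - M)" using Mh(1) by (intro psubset_card_mono) auto
    have fin: "finite (M \<union> N0)" using less.prems finN0 by simp
    have sub: "M \<union> N0 \<subseteq> topspace X" using less.prems N0(1) Mh(2) by auto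
    obtain ls M' where ls: "ls \<in> lists (selectors \<times> UNIV)"
      and M': "finite M'" "M' \<subseteq> topspace X"
        "\<forall>s\<in>K. \<forall>t\<in>K. (\<forall>x\<in>D \<union> M'. s x = t x) \<longrightarrow> \<bar>f s - f t\<bar> \<le> e"
      and conv: "\<forall>b g. (\<forall>M. lsc_seminorm K 2 (b M)) \<longrightarrow> (\<forall>n. g n \<in> bdd_on K) \<longrightarrow>
        midpoint_conv (tower ls b (M \<union> N0)) f g \<longrightarrow> midpoint_conv (b M') f g"
      using less.hyps[OF decr fin sub] by (elim exE conjE) (rule that)
    have lsS: "S M N \<subseteq> K \<times> K" if "S \<in> fst ` set ls" for S M N
      using that ls by (auto intro!: selectors_subset)
    have "\<exists>k. \<forall>b g. (\<forall>M. lsc_seminorm K 2 (b M)) \<longrightarrow> (\<forall>n. g n \<in> bdd_on K) \<longrightarrow>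
        midpoint_conv (tower ((S, card N0, k) # ls) b M) f g \<longrightarrow>
        midpoint_conv (tower ls b (M \<union> N0)) f g"
      by (rule tower_descend[of S K ls f N0 "card N0" e M])
        (fact selectors_subset[OF S] lsS f finN0 order.refl e large small)+
    then obtain k where k: "\<forall>b g. (\<forall>M. lsc_seminorm K 2 (b M)) \<longrightarrow> (\<forall>n. g n \<in> bdd_on K) \<longrightarrow>
        midpoint_conv (tower ((S, card N0, k) # ls) b M) f g \<longrightarrow>
        midpoint_conv (tower ls b (M \<union> N0)) f g" ..
    show ?thesis
    proof (intro exI[of _ "(S, card N0, k) # ls"] exI[of _ M'] conjI allI impI)
      show "(S, card N0, k) # ls \<in> lists (selectors \<times> UNIV)" using S ls by auto
      fix b g
      assume b: "\<forall>M. lsc_seminorm K 2 (b M)" and g: "\<forall>n. g n \<in> bdd_on K"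
        and c: "midpoint_conv (tower ((S, card N0, k) # ls) b M) f g"
      have "midpoint_conv (tower ls b (M \<union> N0)) f g" using k b g c by blast
      then show "midpoint_conv (b M') f g" using conv b g by blast
    qed (use M' in auto)
  qed
qed

section \<open>Cells\<close>

text \<open>A cell prescribes the values of its members on \<open>D0 \<union> M\<close> up to \<open>1 / Suc n\<close>. Since \<open>M\<close> is not among
  countably many sets, its points are addressed through basic open sets \<open>V\<close>.\<close>

definition cell :: "nat \<Rightarrow> 'a set \<Rightarrow> ('a set \<times> int) set \<Rightarrow> 'a set \<Rightarrow> ('a \<Rightarrow> real) set" where
  "cell n D0 L M = {s \<in> K. \<forall>(V, i)\<in>L. \<forall>\<gamma>\<in>V \<inter> (D0 \<union> M). \<lfloor>real (Suc n) * s \<gamma>\<rfloor> = i}"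

definition cell_seminorm :: "real \<Rightarrow> nat \<Rightarrow> 'a set \<Rightarrow> ('a set \<times> int) set \<Rightarrow> 'a set
    \<Rightarrow> (('a \<Rightarrow> real) \<Rightarrow> real) \<Rightarrow> real" where
  "cell_seminorm a n D0 L M = pair_seminorm a (cell n D0 L M \<times> cell n D0 L M)"

definition cell_seminorms :: "('a set \<Rightarrow> (('a \<Rightarrow> real) \<Rightarrow> real) \<Rightarrow> real) set" where
  "cell_seminorms = (\<lambda>(a, n, D0, L). cell_seminorm a n D0 L) `
     ({-1, 1} \<times> UNIV \<times> {D0. finite D0 \<and> D0 \<subseteq> D} \<times> {L. finite L \<and> L \<subseteq> \<B> \<times> UNIV})"

lemma countable_cell_seminorms: "countable cell_seminorms"
proof -
  show ?thesis unfolding cell_seminorms_def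
    by (intro countable_image countable_SIGMA countable_Collect_finite_subset countableI_type
        countable_insert countable_empty countable_base countable_D)
qed

lemma cell_subset: "cell n D0 L M \<subseteq> K"
  by (auto simp: cell_def)

lemma cell_seminorms: "b \<in> cell_seminorms \<Longrightarrow> lsc_seminorm K 2 (b M)"
  unfolding cell_seminorms_def cell_seminorm_def
  by (auto intro!: pair_seminorm dest: subsetD[OF cell_subset])

lemma coordinates_bounded:
  assumes "\<gamma> \<in> topspace X"
  obtains c where "\<And>s. s \<in> K \<Longrightarrow> \<bar>s \<gamma>\<bar> \<le> c"
proof -
  have "compactin euclideanreal ((\<lambda>s. s \<gamma>) ` K)"
    by (rule image_compactin[OF compact_K continuous_map_product_projection[OF assms]])
  then have "bounded ((\<lambda>s. s \<gamma>) ` K)" by (simp add: compact_imp_bounded)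
  then show ?thesis using that by (auto simp: bounded_iff)
qed

lemma cell_cover:
  assumes F: "finite (D0 \<union> M)" "D0 \<union> M \<subseteq> topspace X"
  obtains \<L> where "finite \<L>" "\<And>L. L \<in> \<L> \<Longrightarrow> finite L \<and> L \<subseteq> \<B> \<times> UNIV"
    "\<And>s. s \<in> K \<Longrightarrow> \<exists>L\<in>\<L>. s \<in> cell n D0 L M"
    "\<And>L s t \<gamma>. L \<in> \<L> \<Longrightarrow> s \<in> cell n D0 L M \<Longrightarrow> t \<in> cell n D0 L M \<Longrightarrow> \<gamma> \<in> D0 \<union> M
       \<Longrightarrow> \<bar>s \<gamma> - t \<gamma>\<bar> \<le> 1 / real (Suc n)"
proof -
  have "\<exists>V\<in>\<B>. V \<inter> (D0 \<union> M) = {\<gamma>}" if \<gamma>: "\<gamma> \<in> D0 \<union> M" for \<gamma>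
  proof -
    have "closedin X (D0 \<union> M - {\<gamma>})"
      by (rule t1[unfolded t1_space_closedin_finite, rule_format]) (use F in auto)
    then have "openin X (topspace X - (D0 \<union> M - {\<gamma>}))" by blast
    then obtain V where "V \<in> \<B>" "\<gamma> \<in> V" "V \<subseteq> topspace X - (D0 \<union> M - {\<gamma>})"
      using base[of _ \<gamma>] \<gamma> F(2) by blast
    then show ?thesis using \<gamma> by blast
  qed
  then obtain V where V: "\<And>\<gamma>. \<gamma> \<in> D0 \<union> M \<Longrightarrow> V \<gamma> \<in> \<B> \<and> V \<gamma> \<inter> (D0 \<union> M) = {\<gamma>}" by metis
  have "\<exists>c. \<forall>s\<in>K. \<bar>s \<gamma>\<bar> \<le> c" if "\<gamma> \<in> D0 \<union> M" for \<gamma>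
    using coordinates_bounded[of \<gamma>] that F(2) by (meson subsetD)
  then obtain c where c: "\<And>\<gamma> s. \<gamma> \<in> D0 \<union> M \<Longrightarrow> s \<in> K \<Longrightarrow> \<bar>s \<gamma>\<bar> \<le> c \<gamma>" by metis
  \<comment> \<open>Boundedness of the coordinates leaves finitely many values for the integer parts.\<close>
  define L where "L = (\<lambda>s. (\<lambda>\<gamma>. (V \<gamma>, \<lfloor>real (Suc n) * s \<gamma>\<rfloor>)) ` (D0 \<union> M))"
  define I where "I = (\<Union>\<gamma>\<in>D0 \<union> M. {V \<gamma>} \<times> {\<lfloor>real (Suc n) * - c \<gamma>\<rfloor>..\<lfloor>real (Suc n) * c \<gamma>\<rfloor>})"
  have "L s \<subseteq> I" if "s \<in> K" for s
  proof -
    have "\<lfloor>real (Suc n) * - c \<gamma>\<rfloor> \<le> \<lfloor>real (Suc n) * s \<gamma>\<rfloor>"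
      "\<lfloor>real (Suc n) * s \<gamma>\<rfloor> \<le> \<lfloor>real (Suc n) * c \<gamma>\<rfloor>" if "\<gamma> \<in> D0 \<union> M" for \<gamma>
      using c[OF that \<open>s \<in> K\<close>] by (intro floor_mono mult_left_mono; auto)+
    then show ?thesis by (auto simp: L_def I_def)
  qed
  then have sub: "L ` K \<subseteq> Pow I" by auto
  have finI: "finite I" unfolding I_def using F(1) by auto
  show ?thesis
  proof (rule that[of "L ` K"])
    show "finite (L ` K)" using sub finI by (meson finite_Pow_iff finite_subset)
    show "finite l \<and> l \<subseteq> \<B> \<times> UNIV" if "l \<in> L ` K" for l
      using that V F(1) by (auto simp: L_def)
    show "\<exists>l\<in>L ` K. s \<in> cell n D0 l M" if s: "s \<in> K" for s
    proof (rule bexI[of _ "L s"])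
      have "\<gamma>' = \<gamma>" if "\<gamma> \<in> D0 \<union> M" "\<gamma>' \<in> V \<gamma> \<inter> (D0 \<union> M)" for \<gamma> \<gamma>' using V[OF that(1)] that(2) by blast
      then show "s \<in> cell n D0 (L s) M" using s by (fastforce simp: cell_def L_def)
    qed (use s in auto)
    fix l s t \<gamma>
    assume l: "l \<in> L ` K" and st: "s \<in> cell n D0 l M" "t \<in> cell n D0 l M" and \<gamma>: "\<gamma> \<in> D0 \<union> M"
    then obtain i where i: "(V \<gamma>, i) \<in> l" by (auto simp: L_def)
    have "\<gamma> \<in> V \<gamma> \<inter> (D0 \<union> M)" using V[OF \<gamma>] by blast
    then have "\<lfloor>real (Suc n) * s \<gamma>\<rfloor> = \<lfloor>real (Suc n) * t \<gamma>\<rfloor>" using st i by (fastforce simp: cell_def)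
    then have "\<bar>real (Suc n) * s \<gamma> - real (Suc n) * t \<gamma>\<bar> \<le> 1" by linarith
    then have "real (Suc n) * \<bar>s \<gamma> - t \<gamma>\<bar> \<le> 1"
      by (simp only: right_diff_distrib[symmetric] abs_mult abs_of_nat)
    then show "\<bar>s \<gamma> - t \<gamma>\<bar> \<le> 1 / real (Suc n)" by (simp add: field_simps)
  qed
qed

end

section \<open>The norm\<close>

text \<open>On a set where \<open>h\<close> oscillates by at most \<open>c\<close>, the sums \<open>h u + h v\<close> are all close to \<open>2 * h s\<close>.\<close>

lemma pair_seminorm_on_square:
  assumes B: "B \<subseteq> K" and s: "s \<in> B" and h: "h \<in> bdd_on K"
    and c: "pair_seminorm (-1) (B \<times> B) h \<le> c"
  shows "2 * \<bar>h s\<bar> \<le> pair_seminorm 1 (B \<times> B) h"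
    and "pair_seminorm 1 (B \<times> B) h \<le> 2 * \<bar>h s\<bar> + 2 * c"
proof -
  have BB: "B \<times> B \<subseteq> K \<times> K" using B by auto
  show "2 * \<bar>h s\<bar> \<le> pair_seminorm 1 (B \<times> B) h"
    using pair_seminorm_ge[OF BB _ h, of 1 s s] s by simp
  have close: "\<bar>h u - h s\<bar> \<le> c" if "u \<in> B" for u
    using pair_seminorm_ge[OF BB _ h, of "-1" u s] s that c by simp
  have "0 \<le> c" using close[OF s] by simp
  then show "pair_seminorm 1 (B \<times> B) h \<le> 2 * \<bar>h s\<bar> + 2 * c"
  proof (intro pair_seminorm_le)
    fix u v assume "(u, v) \<in> B \<times> B"
    then show "\<bar>h u + 1 * h v\<bar> \<le> 2 * \<bar>h s\<bar> + 2 * c"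
      using close[of u] close[of v] by auto
  qed auto
qed

text \<open>If \<open>\<bar>x\<bar>\<close>, \<open>\<bar>y\<bar>\<close> and \<open>\<bar>x + y\<bar> / 2\<close> are almost equal, then so are the real numbers \<open>x\<close> and \<open>y\<close>. This is
  applied to the values of \<open>f\<close> and \<open>h\<close> at \<open>s\<close>, which are known through seminorms because both functions are
  almost constant on \<open>B\<close>.\<close>

lemma close_on_square:
  assumes B: "B \<subseteq> K" and s: "s \<in> B" and f: "f \<in> bdd_on K" and h: "h \<in> bdd_on K"
    and osc: "pair_seminorm (-1) (B \<times> B) f \<le> e" "pair_seminorm (-1) (B \<times> B) h \<le> 2 * e"
    and sum: "\<bar>pair_seminorm 1 (B \<times> B) h - pair_seminorm 1 (B \<times> B) f\<bar> \<le> e"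
      "\<bar>pair_seminorm 1 (B \<times> B) (\<lambda>x. (1/2) * (f x + h x)) - pair_seminorm 1 (B \<times> B) f\<bar> \<le> e"
  shows "\<bar>f s - h s\<bar> \<le> 10 * e"
proof -
  have BB: "B \<times> B \<subseteq> K \<times> K" using B by auto
  have "pair_seminorm (-1) (B \<times> B) (\<lambda>x. (1/2) * (f x + h x)) \<le> 3 / 2 * e"
    using seminorm_midpoint_le[OF pair_seminorm[OF BB] f h, of "-1"] osc by simp
  note 1 = pair_seminorm_on_square[OF B s f osc(1)]
    and 2 = pair_seminorm_on_square[OF B s h osc(2)]
    and 3 = pair_seminorm_on_square[OF B s bdd_on_midpoint[OF f h] this]
  show ?thesis using 1 2 3 sum by (simp add: abs_mult)
qed

context bounded_rank_compactum
begin

lemma norm_with_midpoint_convergence: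
  obtains \<nu> where "lsc_seminorm K 2 \<nu>" "\<And>f. f \<in> bdd_on K \<Longrightarrow> unorm K f \<le> \<nu> f"
    "\<And>f g ls b. f \<in> bdd_on K \<Longrightarrow> (\<forall>n. g n \<in> bdd_on K) \<Longrightarrow> midpoint_conv \<nu> f g
       \<Longrightarrow> ls \<in> lists (selectors \<times> UNIV) \<Longrightarrow> b \<in> cell_seminorms \<Longrightarrow> midpoint_conv (tower ls b {}) f g"
proof -
  define \<F> where "\<F> = (\<lambda>(ls, b). tower ls b {}) ` (lists (selectors \<times> (UNIV :: (nat \<times> nat) set)) \<times> cell_seminorms)"
  have count: "countable \<F>" unfolding \<F>_def
    by (intro countable_image countable_SIGMA countable_lists countable_selectors
        countable_cell_seminorms countableI_type)
  have semi: "\<exists>C. lsc_seminorm K C p" if p_in: "p \<in> \<F>" for p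
  proof -
    obtain ls b where p: "p = tower ls b {}" "ls \<in> lists (selectors \<times> UNIV)" "b \<in> cell_seminorms"
      using p_in by (auto simp: \<F>_def)
    have "S M N \<subseteq> K \<times> K" if "S \<in> fst ` set ls" for S M N
      using that p(2) by (auto intro!: selectors_subset)
    then show ?thesis using tower_seminorm[of K b ls "{}"] cell_seminorms[OF p(3)] p(1) by blast
  qed
  obtain \<nu> where \<nu>: "lsc_seminorm K 2 \<nu>" "\<And>f. f \<in> bdd_on K \<Longrightarrow> unorm K f \<le> \<nu> f"
    "\<And>f g p. f \<in> bdd_on K \<Longrightarrow> (\<forall>n. g n \<in> bdd_on K) \<Longrightarrow> midpoint_conv \<nu> f g \<Longrightarrow> p \<in> \<F>
       \<Longrightarrow> midpoint_conv p f g"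
    by (rule countable_seminorms_combine[OF count semi], assumption) (rule that)
  show ?thesis
  proof (rule that[OF \<nu>(1,2)])
    fix f g and ls :: "(_ \<times> nat \<times> nat) list" and b
    assume *: "f \<in> bdd_on K" "\<forall>n. g n \<in> bdd_on K" "midpoint_conv \<nu> f g"
      and "ls \<in> lists (selectors \<times> UNIV)" "b \<in> cell_seminorms"
    then have "tower ls b {} \<in> \<F>" unfolding \<F>_def by (intro image_eqI[of _ _ "(ls, b)"]) auto
    then show "midpoint_conv (tower ls b {}) f g" by (rule \<nu>(3)[OF *])
  qed auto
qed

text \<open>The towers reveal a finite set \<open>M\<close> for which \<open>D \<union> M\<close> controls \<open>f\<close>. By compactness finitely many points of
  \<open>D\<close> suffice, and \<open>K\<close> is covered by finitely many cells on which \<open>f\<close> is almost constant. Midpoint convergence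
  for the oscillation seminorm of a cell makes \<open>g n\<close> almost constant there as well, and the
  other cell seminorm then forces \<open>g n\<close> to be close to \<open>f\<close>.\<close>

lemma uniform_convergence_of_midpoint_conv:
  assumes f: "f \<in> bdd_on K"
    and cont: "continuous_map (subtopology (pointwise_topology (topspace X)) K) euclideanreal f"
    and g: "\<And>n. g n \<in> bdd_on K"
    and towers: "\<And>ls b. ls \<in> lists (selectors \<times> UNIV) \<Longrightarrow> b \<in> cell_seminorms
      \<Longrightarrow> midpoint_conv (tower ls b {}) f g"
    and e: "0 < e"
  shows "\<forall>\<^sub>F n in sequentially. \<forall>s\<in>K. \<bar>f s - g n s\<bar> \<le> 10 * e"
proof -
  have Ksub: "K \<subseteq> topspace X \<rightarrow>\<^sub>E UNIV"
    using compactin_subset_topspace[OF compact_K] by simp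
  have "s = t" if "s \<in> K" "t \<in> K" "\<And>\<gamma>. \<gamma> \<in> topspace X \<Longrightarrow> s \<gamma> = t \<gamma>" for s t
    by (rule PiE_ext[OF subsetD[OF Ksub that(1)] subsetD[OF Ksub that(2)] that(3)])
  then have "\<bar>f s - f t\<bar> < e / 2" if "s \<in> K" "t \<in> K" "\<And>\<gamma>. \<gamma> \<in> topspace X \<Longrightarrow> s \<gamma> = t \<gamma>" for s t
    using that e by fastforce
  from finite_control[OF compact_K cont order.refl this]
  obtain Mh k where Mh: "finite Mh" "Mh \<subseteq> topspace X"
    and k: "\<And>s t. s \<in> K \<Longrightarrow> t \<in> K \<Longrightarrow> (\<And>\<gamma>. \<gamma> \<in> Mh \<Longrightarrow> \<bar>s \<gamma> - t \<gamma>\<bar> \<le> 1 / real (Suc k))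
      \<Longrightarrow> \<bar>f s - f t\<bar> < e / 2"
    by blast
  \<comment> \<open>The jump sets belong to half the distance that the control points allow.\<close>
  have half: "2 / real (Suc (2 * k + 1)) = 1 / real (Suc k)" by (simp add: field_simps)
  have "\<bar>f s - f t\<bar> \<le> e / 2" if "s \<in> K" "t \<in> K"
    "\<And>\<gamma>. \<gamma> \<in> Mh \<Longrightarrow> \<bar>s \<gamma> - t \<gamma>\<bar> \<le> 2 / real (Suc (2 * k + 1))" for s t
    using k[OF that(1,2)] that(3) unfolding half by (meson less_imp_le)
  then have "\<exists>ls M. ls \<in> lists (selectors \<times> UNIV) \<and> finite M \<and> M \<subseteq> topspace X \<and>
      (\<forall>s\<in>K. \<forall>t\<in>K. (\<forall>x\<in>D \<union> M. s x = t x) \<longrightarrow> \<bar>f s - f t\<bar> \<le> e / 2) \<and>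
      (\<forall>b g. (\<forall>M. lsc_seminorm K 2 (b M)) \<longrightarrow> (\<forall>n. g n \<in> bdd_on K) \<longrightarrow>
        midpoint_conv (tower ls b {}) f g \<longrightarrow> midpoint_conv (b M) f g)"
    using e by (intro descend_to_control[OF f _ Mh, where m = "2 * k + 1"]) simp_all
  then obtain ls M where ls: "ls \<in> lists (selectors \<times> UNIV)" and M: "finite M" "M \<subseteq> topspace X"
    and ctrl: "\<forall>s\<in>K. \<forall>t\<in>K. (\<forall>x\<in>D \<union> M. s x = t x) \<longrightarrow> \<bar>f s - f t\<bar> \<le> e / 2"
    and conv: "\<forall>b g. (\<forall>M. lsc_seminorm K 2 (b M)) \<longrightarrow> (\<forall>n. g n \<in> bdd_on K) \<longrightarrow>
      midpoint_conv (tower ls b {}) f g \<longrightarrow> midpoint_conv (b M) f g"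
    by (elim exE conjE) (rule that)
  have conv_cell: "midpoint_conv (b M) f g" if "b \<in> cell_seminorms" for b
    using conv cell_seminorms[OF that] g towers[OF ls that] by blast
  have "D \<union> M \<subseteq> topspace X" using D(1) M(2) by auto
  moreover have "\<bar>f s - f t\<bar> < e" if "s \<in> K" "t \<in> K" "\<And>x. x \<in> D \<union> M \<Longrightarrow> s x = t x" for s t
  proof -
    have "\<bar>f s - f t\<bar> \<le> e / 2" using ctrl that by blast
    then show ?thesis using e by simp
  qed
  ultimately obtain F n where F: "finite F" "F \<subseteq> D \<union> M"
    and n: "\<And>s t. s \<in> K \<Longrightarrow> t \<in> K \<Longrightarrow> (\<And>\<gamma>. \<gamma> \<in> F \<Longrightarrow> \<bar>s \<gamma> - t \<gamma>\<bar> \<le> 1 / real (Suc n)) \<Longrightarrow> \<bar>f s - f t\<bar> < e"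
    using finite_control[OF compact_K cont] by metis
  define D0 where "D0 = F \<inter> D"
  have D0: "finite D0" "D0 \<subseteq> D" and FD: "F \<subseteq> D0 \<union> M" using F by (auto simp: D0_def)
  have "finite (D0 \<union> M)" "D0 \<union> M \<subseteq> topspace X" using D0 M D(1) by auto
  from cell_cover[OF this, of n] obtain \<L> where \<L>: "finite \<L>" "\<And>L. L \<in> \<L> \<Longrightarrow> finite L \<and> L \<subseteq> \<B> \<times> UNIV"
    and cover: "\<And>s. s \<in> K \<Longrightarrow> \<exists>L\<in>\<L>. s \<in> cell n D0 L M"
    and small: "\<And>L s t \<gamma>. L \<in> \<L> \<Longrightarrow> s \<in> cell n D0 L M \<Longrightarrow> t \<in> cell n D0 L M \<Longrightarrow> \<gamma> \<in> D0 \<union> M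
       \<Longrightarrow> \<bar>s \<gamma> - t \<gamma>\<bar> \<le> 1 / real (Suc n)"
    by blast
  have "\<forall>\<^sub>F j in sequentially. \<forall>s\<in>cell n D0 L M. \<bar>f s - g j s\<bar> \<le> 10 * e" if L: "L \<in> \<L>" for L
  proof -
    define B where "B = cell n D0 L M"
    have BK: "B \<subseteq> K" unfolding B_def by (rule cell_subset)
    have "cell_seminorm a n D0 L \<in> cell_seminorms" if "a \<in> {-1, 1}" for a
      unfolding cell_seminorms_def using that D0 \<L>(2)[OF L]
      by (intro image_eqI[of _ _ "(a, n, D0, L)"]) auto
    from conv_cell[OF this]
    have lim: "(\<lambda>j. pair_seminorm a (B \<times> B) (g j)) \<longlonglongrightarrow> pair_seminorm a (B \<times> B) f"
      "(\<lambda>j. pair_seminorm a (B \<times> B) (\<lambda>x. (1/2) * (f x + g j x))) \<longlonglongrightarrow> pair_seminorm a (B \<times> B) f"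
      if "a \<in> {-1, 1}" for a
      using that by (auto simp: midpoint_conv_def cell_seminorm_def B_def)
    have osc: "pair_seminorm (-1) (B \<times> B) f \<le> e"
    proof (rule pair_seminorm_le)
      fix s t assume "(s, t) \<in> B \<times> B"
      then have st: "s \<in> B" "t \<in> B" by auto
      have "\<bar>f s - f t\<bar> < e"
        by (rule n) (use st BK FD small[OF L] in \<open>auto simp: B_def\<close>)
      then show "\<bar>f s + -1 * f t\<bar> \<le> e" by simp
    qed (use e in simp)
    have "\<forall>\<^sub>F j in sequentially. dist (pair_seminorm (-1) (B \<times> B) (g j)) (pair_seminorm (-1) (B \<times> B) f) < e"
      "\<forall>\<^sub>F j in sequentially. dist (pair_seminorm 1 (B \<times> B) (g j)) (pair_seminorm 1 (B \<times> B) f) < e"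
      "\<forall>\<^sub>F j in sequentially. dist (pair_seminorm 1 (B \<times> B) (\<lambda>x. (1/2) * (f x + g j x)))
         (pair_seminorm 1 (B \<times> B) f) < e"
      using tendstoD[OF lim(1) e] tendstoD[OF lim(2) e] by auto
    then show ?thesis unfolding B_def[symmetric]
    proof eventually_elim
      case (elim j)
      show ?case
      proof
        fix s assume s: "s \<in> B"
        show "\<bar>f s - g j s\<bar> \<le> 10 * e"
          by (rule close_on_square[OF BK s f g osc]) (use elim osc in \<open>auto simp: dist_real_def\<close>)
      qed
    qed
  qed
  then have "\<forall>\<^sub>F j in sequentially. \<forall>L\<in>\<L>. \<forall>s\<in>cell n D0 L M. \<bar>f s - g j s\<bar> \<le> 10 * e"
    using \<L>(1) by (simp add: eventually_ball_finite)
  then show ?thesis by eventually_elim (use cover in blast)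
qed

end

lemma sup_norm_eq_unorm:
  assumes "f \<in> bdd_on (topspace T)"
  shows "sup_norm T f = unorm (topspace T) f"
proof (cases "topspace T = {}")
  case True
  then show ?thesis by (simp add: sup_norm_def unorm_def)
next
  case False
  have le: "\<bar>f x\<bar> \<le> sup_norm T f" if "x \<in> topspace T" for x
  proof -
    have "bdd_above ((\<lambda>x. \<bar>f x\<bar>) ` topspace T)"
      using abs_le_unorm[OF assms] by (rule bdd_aboveI2)
    from cSUP_upper[OF that this] show ?thesis using False by (simp add: sup_norm_def)
  qed
  obtain x0 where "x0 \<in> topspace T" using False by blast
  then have "0 \<le> sup_norm T f" using le by (meson abs_ge_zero order_trans)
  then have "unorm (topspace T) f \<le> sup_norm T f" using le by (rule unorm_le)
  moreover have "sup_norm T f \<le> unorm (topspace T) f"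
    using False abs_le_unorm[OF assms] by (auto simp: sup_norm_def intro: cSUP_least)
  ultimately show ?thesis by simp
qed

theorem theorem2:
  fixes \<Gamma> :: "'a topology" and K :: "('a \<Rightarrow> real) set" and \<Omega> :: "'o rel"
  assumes "Polish_space \<Gamma>"
    and "\<forall>s\<in>K. Baire_one \<Gamma> s"
    and "compactin (pointwise_topology (topspace \<Gamma>)) K"
    and "Well_order \<Omega>" and "countable (Field \<Omega>)"
    and "\<forall>s\<in>K. \<forall>\<delta>>0. derived_iterate \<Gamma> (osc_set \<Gamma> s \<delta>) \<Omega> = {}"
  shows "\<exists>\<nu> :: (('a \<Rightarrow> real) \<Rightarrow> real) \<Rightarrow> real.
    let T = subtopology (pointwise_topology (topspace \<Gamma>)) K in
      is_norm_on K (cfuns T) \<nu> \<and>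
      equivalent_norms_on (cfuns T) (sup_norm T) \<nu> \<and>
      lower_semicontinuous_map (cfuns_pointwise T) \<nu> \<and>
      locally_uniformly_rotund_on K (cfuns T) \<nu>"
proof -
  have met: "metrizable_space \<Gamma>" and sep: "separable_space \<Gamma>"
    using assms(1) by (auto simp: Polish_space_def completely_metrizable_imp_metrizable_space)
  obtain D where D: "countable D" "D \<subseteq> topspace \<Gamma>" "\<Gamma> closure_of D = topspace \<Gamma>"
    using sep by (auto simp: separable_space_def)
  obtain \<B> where \<B>: "countable \<B>" "\<And>V. V \<in> \<B> \<Longrightarrow> openin \<Gamma> V"
    "\<And>U x. openin \<Gamma> U \<Longrightarrow> x \<in> U \<Longrightarrow> \<exists>V\<in>\<B>. x \<in> V \<and> V \<subseteq> U"
    by (rule separable_metrizable_countable_base[OF met sep]) (rule that)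
  interpret bounded_rank_compactum \<Gamma> \<Omega> K \<B> D
    by unfold_locales (use assms met D \<B> in \<open>auto simp: metrizable_imp_t1_space\<close>)
  define T where "T = subtopology (pointwise_topology (topspace \<Gamma>)) K"
  have "K \<subseteq> topspace (pointwise_topology (topspace \<Gamma>))"
    using compact_K by (rule compactin_subset_topspace)
  then have T: "topspace T = K" by (auto simp: T_def)
  have bdd: "f \<in> bdd_on K" if "f \<in> cfuns T" for f
  proof -
    have "compactin T K" using compact_K by (simp add: T_def compactin_subtopology)
    then have "compactin euclideanreal (f ` K)"
      by (rule image_compactin) (use that in \<open>simp add: cfuns_def\<close>)
    then have "bounded (f ` K)" by (simp add: compact_imp_bounded)
    then show ?thesis by (auto simp: bounded_iff bdd_on_def)
  qed
  obtain \<nu> where \<nu>: "lsc_seminorm K 2 \<nu>" "\<And>f. f \<in> bdd_on K \<Longrightarrow> unorm K f \<le> \<nu> f"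
    and conv: "\<And>f g ls b. f \<in> bdd_on K \<Longrightarrow> (\<forall>n. g n \<in> bdd_on K) \<Longrightarrow> midpoint_conv \<nu> f g
       \<Longrightarrow> ls \<in> lists (selectors \<times> UNIV) \<Longrightarrow> b \<in> cell_seminorms \<Longrightarrow> midpoint_conv (tower ls b {}) f g"
    by (rule norm_with_midpoint_convergence) (rule that)
  have restr: "\<nu> (\<lambda>x\<in>K. h x) = \<nu> h" for h by (rule seminorm_restrict[OF \<nu>(1)])
  have "is_norm_on K (cfuns T) \<nu>"
    unfolding is_norm_on_def restr
  proof (intro conjI ballI allI)
    fix f assume f: "f \<in> cfuns T"
    show "0 \<le> \<nu> f" by (rule seminorm_nonneg[OF \<nu>(1) bdd[OF f]])
    show "\<nu> f = 0 \<longleftrightarrow> f = (\<lambda>x\<in>K. 0)"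
    proof
      assume "\<nu> f = 0"
      then have "\<bar>f x\<bar> \<le> 0" if "x \<in> K" for x
        using abs_le_unorm[OF bdd[OF f] that] \<nu>(2)[OF bdd[OF f]] by simp
      then show "f = (\<lambda>x\<in>K. 0)" using f T by (auto simp: cfuns_def extensional_def fun_eq_iff)
    next
      assume "f = (\<lambda>x\<in>K. 0)"
      then show "\<nu> f = 0" using seminorm_scale[OF \<nu>(1) bdd[OF f], of 0] restr[of "\<lambda>_. 0"] by simp
    qed
    show "\<nu> (\<lambda>x. c * f x) = \<bar>c\<bar> * \<nu> f" for c by (rule seminorm_scale[OF \<nu>(1) bdd[OF f]])
    show "\<nu> (\<lambda>x. f x + g x) \<le> \<nu> f + \<nu> g" if "g \<in> cfuns T" for g
      by (rule seminorm_triangle[OF \<nu>(1) bdd[OF f] bdd[OF that]])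
  qed
  moreover have "equivalent_norms_on (cfuns T) (sup_norm T) \<nu>"
    unfolding equivalent_norms_on_def
    by (rule exI[of _ 1], simp, rule exI[of _ 2])
      (use \<nu>(2) seminorm_bound[OF \<nu>(1)] bdd sup_norm_eq_unorm[of _ T] in \<open>simp add: T\<close>)
  moreover have "lower_semicontinuous_map (cfuns_pointwise T) \<nu>"
  proof -
    have sub: "cfuns T \<inter> bdd_on K = cfuns T" using bdd by auto
    have "cfuns_pointwise T
        = subtopology (subtopology (pointwise_topology K) (bdd_on K)) (cfuns T)"
      by (simp add: cfuns_pointwise_def T subtopology_subtopology sub Int_commute[of "bdd_on K"])
    moreover have "lower_semicontinuous_map (subtopology Y S) h"
      if "lower_semicontinuous_map Y h" for Y S and h :: "_ \<Rightarrow> real"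
    proof -
      have "{x \<in> topspace (subtopology Y S). a < h x} = {x \<in> topspace Y. a < h x} \<inter> S" for a by auto
      then show ?thesis using that by (auto simp: lower_semicontinuous_map_def openin_subtopology)
    qed
    ultimately show ?thesis using seminorm_lsc[OF \<nu>(1)] by simp
  qed
  moreover have "locally_uniformly_rotund_on K (cfuns T) \<nu>"
    unfolding locally_uniformly_rotund_on_def restr
  proof (intro ballI allI impI)
    fix f and g :: "nat \<Rightarrow> ('a \<Rightarrow> real) \<Rightarrow> real"
    assume f: "f \<in> cfuns T" and "(\<forall>n. g n \<in> cfuns T) \<and> (\<lambda>n. \<nu> (g n)) \<longlonglongrightarrow> \<nu> f
      \<and> (\<lambda>n. \<nu> (\<lambda>x. 1 / 2 * (f x + g n x))) \<longlonglongrightarrow> \<nu> f"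
    then have g: "\<And>n. g n \<in> bdd_on K" and mid: "midpoint_conv \<nu> f g"
      using bdd by (auto simp: midpoint_conv_def)
    have fc: "continuous_map (subtopology (pointwise_topology (topspace \<Gamma>)) K) euclideanreal f"
      using f by (simp add: cfuns_def T_def)
    have diff: "(\<lambda>x. f x - g n x) \<in> bdd_on K" for n
      using bdd_on_add[OF bdd[OF f] bdd_on_scale[OF g[of n], of "-1"]] by simp
    show "(\<lambda>n. \<nu> (\<lambda>x. f x - g n x)) \<longlonglongrightarrow> 0"
    proof (rule tendstoI)
      fix r :: real assume r: "0 < r"
      have "\<forall>\<^sub>F n in sequentially. \<forall>s\<in>K. \<bar>f s - g n s\<bar> \<le> 10 * (r / 40)"
        by (rule uniform_convergence_of_midpoint_conv[OF bdd[OF f] fc g conv[OF bdd[OF f] allI[OF g] mid]])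
          (use r in auto)
      then show "\<forall>\<^sub>F n in sequentially. dist (\<nu> (\<lambda>x. f x - g n x)) 0 < r"
      proof eventually_elim
        case (elim n)
        have "unorm K (\<lambda>x. f x - g n x) \<le> r / 4" using elim r by (intro unorm_le) auto
        then have "\<nu> (\<lambda>x. f x - g n x) < r" using seminorm_bound[OF \<nu>(1) diff[of n]] r by linarith
        then show ?case using seminorm_nonneg[OF \<nu>(1) diff[of n]] by simp
      qed
    qed
  qed
  ultimately show ?thesis unfolding Let_def T_def[symmetric] by blast
qed

end
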